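(* Let $\mathcal{C}$ be either the category $\mathcal{LRF}$ of labeled rooted forests or the category $\mathcal{LFG}$ of labeled Feynman graphs. For every $M\in\mathrm{Iso}(\mathcal{C})$, the subspace $\mathrm{H}_{\leq M}\subset\mathrm{H}^*_{\mathcal{C}}$ is a finite-dimensional representation of $\mathfrak{n}_{\mathcal{C}}$ with respect to the top elimination action $$\phi_B\cdot X_A=-\sum_{N\subset B,\ B/N\simeq A}\phi_N.$$
   Context: **Category $\mathcal{LRF}$.** Fix an infinite label set $S$. A labeled rooted tree is a finite tree $T$ with a distinguished root and an injection $V(T)\hookrightarrow S$; a labeled rooted forest is a finite set of labeled rooted trees with pairwise disjoint label sets. An admissible cut of a tree $T$ is a subset of $E(T)$ containing at most one edge on any path from a leaf to the root; removing the cut edges gives a forest $P_C(T)$ (the components not containing the root) and a tree $R_C(T)$ (the component containing the root). The empty cut $C_{null}$ (with $P=\emptyset$, $R=T$) and the formal full cut $C_{full}$ (with $P=T$, $R=\emptyset$) are admissible. A cut $C$ of a forest $F$ is a choice of cut of each tree, with $P_C(F)$, $R_C(F)$ the unions of the corresponding parts. Isomorphisms of forests are bijections of trees and of their vertices preserving roots and incidences (labels are ignored). Objects are labeled rooted forests and the empty forest $\emptyset$ (zero object); $\mathrm{Hom}(F_1,F_2)$ is the set of triples $(C_1,C_2,f)$ with $C_i$ an admissible cut of $F_i$ and $f:R_{C_1}(F_1)\cong P_{C_2}(F_2)$. A subobject of $F$ is $N=P_C(F)$ for an admissible cut $C$, with quotient $F/N=R_C(F)$; different cuts give different subobjects. **Category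 $\mathcal{LFG}$ ($\phi^3$ theory).** A graph has half-edges $H$ and vertices $V$; each half-edge is adjacent to exactly one vertex and at most one other half-edge. Half-edges not adjacent to another half-edge are external edges; pairs of adjacent half-edges are internal edges. A Feynman graph is a (possibly disconnected) graph in which each vertex has exactly three half-edges, and each connected component has 2 or 3 external edges and at least one loop. A labeled Feynman graph has its half-edges labeled bijectively by a set. Isomorphisms are bijections of vertices and half-edges preserving incidences (labels are ignored). A subgraph $\gamma\subset\Gamma$ is a Feynman graph with $V(\gamma)\subset V(\Gamma)$, $H(\gamma)\subset H(\Gamma)$, containing all half-edges at its vertices, with incidences inherited from $\Gamma$. For $\gamma$ connected, $\Gamma/\gamma$ is obtained as follows: if $\gamma$ has 3 external edges, replace $\gamma$ by a single new trivalent vertex to which the external half-edges of $\gamma$ are attached; if $\gamma$ has 2 external edges, delete all vertices and half-edges of $\gamma$ and join the half-edges to which its two external half-edges were joined. For general $\gamma$ take successive quotients by components. The quotient of a connected component by itself is empty; in particular $\Gamma/\Gamma=\emptyset$. Objects are labeled Feynman graphs and the empty graph $\emptyset$ (zero object); $\mathrm{Hom}(\Gamma_1,\Gamma_2)$ is the set of triples $(\gamma_1,\gamma_2,f)$ with $\gamma_i\subset\Gamma_i$ subgraphs (possibly $\emptyset$ or $\Gamma_i$) and $f:\Gamma_1/\gamma_1\cong\gamma_2$. Subobjects of $\Gamma$ are its subgraphs $\gamma$ (including $\emptyset$, $\Gamma$), with quotient $\Gamma/\gamma$. **Known facts on $\mathcal{C}$.** $\oplus$ denotes disjoint union. For $A\subset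 B$ there is an inclusion-preserving bijection between subobjects $S$ of $B$ containing $A$ and subobjects $\overline S$ of $B/A$, with $(B/A)/\overline S\cong B/S$. Subobjects of subobjects are subobjects. An object is decomposable if it is of the form $A\oplus B$ with $A,B\ne\emptyset$, and indecomposable otherwise. **Hall algebra.** $\mathrm{Iso}(\mathcal{C})$ is the set of isomorphism classes. $\mathrm{H}_{\mathcal{C}}$ is the $\mathbb{Q}$-vector space of finitely supported functions $\mathrm{Iso}(\mathcal{C})\to\mathbb{Q}$, with basis of delta functions $\delta_A$, product $(f\times g)(M)=\sum_{N\subset M}f(N)g(M/N)$ (sum over subobjects of a representative of $M$) and coproduct $\Delta(f)(M,N)=f(M\oplus N)$. It is a cocommutative Hopf algebra, isomorphic to $U(\mathfrak{n}_{\mathcal{C}})$, where $\mathfrak{n}_{\mathcal{C}}$ is its Lie algebra of primitive elements, with basis the $X_A:=\delta_A$ for $A$ nonempty indecomposable. $\mathrm{H}^*_{\mathcal{C}}$ is the restricted dual, with basis $\{\phi_A\}$ dual to $\{\delta_A\}$. **Action and subspace.** The top elimination action is the right action of $\mathfrak{n}_{\mathcal{C}}$ on $\mathrm{H}^*_{\mathcal{C}}$ given by the formula in the claim for $X_A\in\mathfrak{n}_{\mathcal{C}}$ and $B\in\mathrm{Iso}(\mathcal{C})$, the sum running over subobjects $N$ of a representative of $B$ with $B/N\simeq A$; a right action is regarded as a left module structure via $X\cdot m:=-\,m\cdot X$ for $X\in\mathfrak{n}_{\mathcal{C}}$. For $M\in\mathrm{Iso}(\mathcal{C})$, $\leq M$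 denotes the set of $E\in\mathrm{Iso}(\mathcal{C})$ that are (classes of) subobjects of $M$, and $\mathrm{H}_{\leq M}$ is the span of $\{\phi_E : E\in\ \leq M\}$ in $\mathrm{H}^*_{\mathcal{C}}$.
   Formalization: For labeled Feynman graphs, compatibility of the action with the Lie bracket is proved only when the Hall product is associative at all classes E ≤ M; with the given definitions it fails for some M. Finite dimension and stability hold for every M, and the forest case is complete. *)

theory Defs
  imports Complex_Main "HOL-Library.FuncSet" "HOL-Library.Function_Algebras"
    "HOL-Library.Infinite_Typeclass"
begin

section \<open>Rational vector spaces of functions\<close>

definition scl :: "rat \<Rightarrow> ('x \<Rightarrow> rat) \<Rightarrow> 'x \<Rightarrow> rat"
  where "scl c f = (\<lambda>x. c * f x)"

global_interpretation rat_fun: vector_space "scl :: rat \<Rightarrow> ('x \<Rightarrow> rat) \<Rightarrow> 'x \<Rightarrow> rat"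
  by unfold_locales (simp_all add: scl_def fun_eq_iff algebra_simps)

definition finite_dim :: "('x \<Rightarrow> rat) set \<Rightarrow> bool"
  where "finite_dim W \<longleftrightarrow> (\<exists>B. finite B \<and> rat_fun.span B = W)"

text \<open>
  \<open>stable_action L W act\<close>: the bilinear map \<open>act\<close> makes every element of the space \<open>L\<close> act by
  a linear endomorphism on the subspace \<open>W\<close>.  A \<open>lie_module\<close> is such an action which is in
  addition compatible with the bracket \<open>br\<close> of \<open>L\<close> (left modules).
\<close>

definition stable_action ::
    "('x \<Rightarrow> rat) set \<Rightarrow> ('y \<Rightarrow> rat) set \<Rightarrow>
     (('x \<Rightarrow> rat) \<Rightarrow> ('y \<Rightarrow> rat) \<Rightarrow> ('y \<Rightarrow> rat)) \<Rightarrow> bool"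
  where "stable_action L W act \<longleftrightarrow>
     rat_fun.subspace L \<and> rat_fun.subspace W \<and>
     (\<forall>X\<in>L. \<forall>m\<in>W. act X m \<in> W) \<and>
     (\<forall>X\<in>L. \<forall>Y\<in>L. \<forall>m\<in>W. act (X + Y) m = act X m + act Y m) \<and>
     (\<forall>c. \<forall>X\<in>L. \<forall>m\<in>W. act (scl c X) m = scl c (act X m)) \<and>
     (\<forall>X\<in>L. \<forall>m\<in>W. \<forall>n\<in>W. act X (m + n) = act X m + act X n) \<and>
     (\<forall>c. \<forall>X\<in>L. \<forall>m\<in>W. act X (scl c m) = scl c (act X m))"

definition lie_module ::
    "('x \<Rightarrow> rat) set \<Rightarrow> (('x \<Rightarrow> rat) \<Rightarrow> ('x \<Rightarrow> rat) \<Rightarrow> ('x \<Rightarrow> rat)) \<Rightarrow>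
     ('y \<Rightarrow> rat) set \<Rightarrow> (('x \<Rightarrow> rat) \<Rightarrow> ('y \<Rightarrow> rat) \<Rightarrow> ('y \<Rightarrow> rat)) \<Rightarrow> bool"
  where "lie_module L br W act \<longleftrightarrow>
     stable_action L W act \<and>
     (\<forall>X\<in>L. \<forall>Y\<in>L. \<forall>m\<in>W. act (br X Y) m = act X (act Y m) - act Y (act X m))"


section \<open>Hall algebras\<close>

text \<open>
  The data of \<open>LRF\<close> and \<open>LFG\<close> from which Hall algebras are built.  The subobjects of an object
  \<open>F\<close> are indexed by the set \<open>Sub F\<close>; \<open>subob F N\<close> and \<open>quot F N\<close> are the subobject and the
  quotient that belong to the index \<open>N\<close>.  \<open>Plus F G\<close> is the disjoint union, meaningful if
  \<open>Disj F G\<close>.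
\<close>

record ('o, 'n) hall_cat =
  Obj :: "'o set"
  Isom :: "'o \<Rightarrow> 'o \<Rightarrow> bool"
  Zero :: 'o
  Disj :: "'o \<Rightarrow> 'o \<Rightarrow> bool"
  Plus :: "'o \<Rightarrow> 'o \<Rightarrow> 'o"
  Sub :: "'o \<Rightarrow> 'n set"
  subob :: "'o \<Rightarrow> 'n \<Rightarrow> 'o"
  quot :: "'o \<Rightarrow> 'n \<Rightarrow> 'o"

definition cls :: "('o, 'n) hall_cat \<Rightarrow> 'o \<Rightarrow> 'o set"
  where "cls C x = {y \<in> Obj C. Isom C x y}"

definition Iso :: "('o, 'n) hall_cat \<Rightarrow> 'o set set"
  where "Iso C = cls C ` Obj C"

definition rep :: "'o set \<Rightarrow> 'o"
  where "rep M = (SOME x. x \<in> M)"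

definition csum :: "('o, 'n) hall_cat \<Rightarrow> 'o set \<Rightarrow> 'o set \<Rightarrow> 'o set"
  where "csum C M N = {x \<in> Obj C. \<exists>a\<in>M. \<exists>b\<in>N. Disj C a b \<and> Isom C x (Plus C a b)}"

definition Hall :: "('o, 'n) hall_cat \<Rightarrow> ('o set \<Rightarrow> rat) set"
  where "Hall C = {f. finite {A. f A \<noteq> 0} \<and> {A. f A \<noteq> 0} \<subseteq> Iso C}"

definition delta :: "'o set \<Rightarrow> 'o set \<Rightarrow> rat"
  where "delta A = (\<lambda>B. if B = A then 1 else 0)"

text \<open>
  If a quotient is not an object then its \<open>cls\<close> is the empty set, which is not in \<open>Iso C\<close>, so
  elements of \<open>Hall C\<close> vanish on it.
\<close>

definition hall_mult ::
    "('o, 'n) hall_cat \<Rightarrow> ('o set \<Rightarrow> rat) \<Rightarrow> ('o set \<Rightarrow> rat) \<Rightarrow> 'o set \<Rightarrow> rat"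
  where "hall_mult C f g = (\<lambda>M. if M \<in> Iso C
     then \<Sum>N\<in>Sub C (rep M). f (cls C (subob C (rep M) N)) * g (cls C (quot C (rep M) N))
     else 0)"

definition hall_bracket ::
    "('o, 'n) hall_cat \<Rightarrow> ('o set \<Rightarrow> rat) \<Rightarrow> ('o set \<Rightarrow> rat) \<Rightarrow> 'o set \<Rightarrow> rat"
  where "hall_bracket C f g = hall_mult C f g - hall_mult C g f"

definition hall_comult :: "('o, 'n) hall_cat \<Rightarrow> ('o set \<Rightarrow> rat) \<Rightarrow> 'o set \<Rightarrow> 'o set \<Rightarrow> rat"
  where "hall_comult C f = (\<lambda>M N. f (csum C M N))"

text \<open>
  Primitive elements: \<open>hall_comult C f\<close> is \<open>f \<otimes> 1 + 1 \<otimes> f\<close>, where the unit \<open>1\<close> is the delta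
  function of the zero object.
\<close>

definition hall_prim :: "('o, 'n) hall_cat \<Rightarrow> ('o set \<Rightarrow> rat) set"
  where "hall_prim C = {f \<in> Hall C. \<forall>M\<in>Iso C. \<forall>N\<in>Iso C.
     hall_comult C f M N =
       f M * delta (cls C (Zero C)) N + delta (cls C (Zero C)) M * f N}"

text \<open>
  Elements of the restricted dual are functionals, and \<open>phi A\<close> is evaluation at \<open>A\<close>.  For \<open>m\<close> in
  \<open>Hall_dual C\<close> the coefficient of \<open>phi B\<close> is \<open>m (delta B)\<close>.
\<close>

definition phi :: "'o set \<Rightarrow> ('o set \<Rightarrow> rat) \<Rightarrow> rat"
  where "phi A = (\<lambda>f. f A)"

definition Hall_dual :: "('o, 'n) hall_cat \<Rightarrow> (('o set \<Rightarrow> rat) \<Rightarrow> rat) set"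
  where "Hall_dual C = rat_fun.span (phi ` Iso C)"

definition top_elim_basis ::
    "('o, 'n) hall_cat \<Rightarrow> 'o set \<Rightarrow> 'o set \<Rightarrow> ('o set \<Rightarrow> rat) \<Rightarrow> rat"
  where "top_elim_basis C B A =
     - (\<Sum>N | N \<in> Sub C (rep B) \<and> cls C (quot C (rep B) N) = A. phi (cls C (subob C (rep B) N)))"

text \<open>Right action of \<open>X\<close> on \<open>m\<close>: the bilinear extension of \<open>top_elim_basis\<close>.\<close>

definition top_elim ::
    "('o, 'n) hall_cat \<Rightarrow> (('o set \<Rightarrow> rat) \<Rightarrow> rat) \<Rightarrow> ('o set \<Rightarrow> rat) \<Rightarrow> ('o set \<Rightarrow> rat) \<Rightarrow> rat"
  where "top_elim C m X =
     (\<Sum>B | B \<in> Iso C \<and> m (delta B) \<noteq> 0. \<Sum>A | A \<in> Iso C \<and> X A \<noteq> 0.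
        scl (m (delta B) * X A) (top_elim_basis C B A))"

lemma top_elim_phi_delta:
  assumes "A \<in> Iso C" "B \<in> Iso C"
  shows "top_elim C (phi B) (delta A) =
    - (\<Sum>N | N \<in> Sub C (rep B) \<and> cls C (quot C (rep B) N) = A. phi (cls C (subob C (rep B) N)))"
proof -
  have B: "{B'. B' \<in> Iso C \<and> phi B (delta B') \<noteq> 0} = {B}"
    using assms by (auto simp: phi_def delta_def)
  have A: "{A'. A' \<in> Iso C \<and> delta A A' \<noteq> 0} = {A}"
    using assms by (auto simp: delta_def)
  show ?thesis
    unfolding top_elim_def B A top_elim_basis_def[symmetric]
    by (simp add: phi_def delta_def scl_def)
qed

definition left_top_elim ::
    "('o, 'n) hall_cat \<Rightarrow> ('o set \<Rightarrow> rat) \<Rightarrow> (('o set \<Rightarrow> rat) \<Rightarrow> rat) \<Rightarrow> ('o set \<Rightarrow> rat) \<Rightarrow> rat"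
  where "left_top_elim C X m = - top_elim C m X"

definition below :: "('o, 'n) hall_cat \<Rightarrow> 'o set \<Rightarrow> 'o set set"
  where "below C M = {E \<in> Iso C. \<exists>N\<in>Sub C (rep M). E = cls C (subob C (rep M) N)}"

definition H_below :: "('o, 'n) hall_cat \<Rightarrow> 'o set \<Rightarrow> (('o set \<Rightarrow> rat) \<Rightarrow> rat) set"
  where "H_below C M = rat_fun.span (phi ` below C M)"

text \<open>
  Associativity of the Hall product, evaluated at the class \<open>E\<close>.  It holds at every class of \<open>LRF\<close>.
  It fails at some classes of \<open>LFG\<close>: a Feynman subgraph of \<open>G / K\<close> that is adjacent to the vertex
  replacing \<open>K\<close> without containing it need not come from a subgraph of \<open>G\<close>, as the union of its
  vertices with those of \<open>K\<close> can span a larger connected graph.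
\<close>

definition hall_assoc_at :: "('o, 'n) hall_cat \<Rightarrow> 'o set \<Rightarrow> bool"
  where "hall_assoc_at C E \<longleftrightarrow> (\<forall>f\<in>Hall C. \<forall>g\<in>Hall C. \<forall>h\<in>Hall C.
     hall_mult C (hall_mult C f g) h E = hall_mult C f (hall_mult C g h) E)"


section \<open>Labeled rooted forests\<close>

text \<open>
  The label set is the universe of an infinite type, and the vertices of a labeled tree are
  identified with their labels.  Edges are pairs \<open>(parent, child)\<close>, that is, they are oriented
  away from the root.
\<close>

record 's rtree =
  tverts :: "'s set"
  tedges :: "('s \<times> 's) set"
  troot :: 's

definition rooted_tree :: "'s rtree \<Rightarrow> bool"
  where "rooted_tree T \<longleftrightarrow>
     finite (tverts T) \<and> troot T \<in> tverts T \<and> tedges T \<subseteq> tverts T \<times> tverts T \<and>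
     (\<forall>u. (u, troot T) \<notin> tedges T) \<and>
     (\<forall>v \<in> tverts T - {troot T}. \<exists>!u. (u, v) \<in> tedges T) \<and>
     (\<forall>v \<in> tverts T. (troot T, v) \<in> (tedges T)\<^sup>*)"

definition rooted_forest :: "'s rtree set \<Rightarrow> bool"
  where "rooted_forest F \<longleftrightarrow>
     finite F \<and> (\<forall>T\<in>F. rooted_tree T) \<and>
     (\<forall>T\<in>F. \<forall>T'\<in>F. T \<noteq> T' \<longrightarrow> tverts T \<inter> tverts T' = {})"

definition leaf :: "'s rtree \<Rightarrow> 's \<Rightarrow> bool"
  where "leaf T v \<longleftrightarrow> v \<in> tverts T \<and> (\<forall>w. (v, w) \<notin> tedges T)"

definition root_path :: "'s rtree \<Rightarrow> 's \<Rightarrow> ('s \<times> 's) set"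
  where "root_path T l = {(u, v) \<in> tedges T. (v, l) \<in> (tedges T)\<^sup>*}"

definition admissible :: "'s rtree \<Rightarrow> ('s \<times> 's) set \<Rightarrow> bool"
  where "admissible T C \<longleftrightarrow>
     C \<subseteq> tedges T \<and> (\<forall>l. leaf T l \<longrightarrow> card (C \<inter> root_path T l) \<le> 1)"

datatype 's cut = Full_Cut | Edge_Cut "('s \<times> 's) set"

definition cuts :: "'s rtree \<Rightarrow> 's cut set"
  where "cuts T = insert Full_Cut (Edge_Cut ` {C. admissible T C})"

text \<open>
  The connected component of \<open>T\<close> without the edges \<open>C\<close> in which \<open>r\<close> is the vertex nearest to the
  root of \<open>T\<close>.
\<close>

definition branch :: "'s rtree \<Rightarrow> ('s \<times> 's) set \<Rightarrow> 's \<Rightarrow> 's rtree"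
  where "branch T C r =
     (let V = {v. (r, v) \<in> (tedges T - C)\<^sup>*}
      in \<lparr>tverts = V, tedges = (tedges T - C) \<inter> V \<times> V, troot = r\<rparr>)"

fun cut_P :: "'s rtree \<Rightarrow> 's cut \<Rightarrow> 's rtree set"
  where
    "cut_P T Full_Cut = {T}"
  | "cut_P T (Edge_Cut C) = {branch T C v | u v. (u, v) \<in> C}"

fun cut_R :: "'s rtree \<Rightarrow> 's cut \<Rightarrow> 's rtree set"
  where
    "cut_R T Full_Cut = {}"
  | "cut_R T (Edge_Cut C) = {branch T C (troot T)}"

definition tree_iso :: "'s rtree \<Rightarrow> 's rtree \<Rightarrow> bool"
  where "tree_iso T T' \<longleftrightarrow> (\<exists>f. bij_betw f (tverts T) (tverts T') \<and> f (troot T) = troot T' \<and>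
     (\<forall>u\<in>tverts T. \<forall>v\<in>tverts T. (u, v) \<in> tedges T \<longleftrightarrow> (f u, f v) \<in> tedges T'))"

definition forest_iso :: "'s rtree set \<Rightarrow> 's rtree set \<Rightarrow> bool"
  where "forest_iso F F' \<longleftrightarrow> (\<exists>s. bij_betw s F F' \<and> (\<forall>T\<in>F. tree_iso T (s T)))"

text \<open>
  Distinct cuts of a forest give distinct subobjects, so subobjects are indexed by cuts.
\<close>

definition LRF :: "('s::infinite rtree set, 's rtree \<Rightarrow> 's cut) hall_cat"
  where "LRF = \<lparr>
     Obj = {F. rooted_forest F},
     Isom = forest_iso,
     Zero = {},
     Disj = (\<lambda>F G. (\<Union>T\<in>F. tverts T) \<inter> (\<Union>T\<in>G. tverts T) = {}),
     Plus = (\<union>),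
     Sub = (\<lambda>F. PiE F cuts),
     subob = (\<lambda>F c. \<Union>T\<in>F. cut_P T (c T)),
     quot = (\<lambda>F c. \<Union>T\<in>F. cut_R T (c T))\<rparr>"


section \<open>Labeled Feynman graphs\<close>

text \<open>
  Half-edges are identified with their labels.  \<open>att\<close> is the adjacency of half-edges and vertices,
  \<open>adj\<close> the (symmetric) adjacency of half-edges.
\<close>

record ('v, 'h) hgraph =
  verts :: "'v set"
  halfs :: "'h set"
  att :: "('h \<times> 'v) set"
  adj :: "('h \<times> 'h) set"

definition half_edge_graph :: "('v, 'h) hgraph \<Rightarrow> bool"
  where "half_edge_graph G \<longleftrightarrow>
     finite (verts G) \<and> finite (halfs G) \<and>
     att G \<subseteq> halfs G \<times> verts G \<and> (\<forall>h\<in>halfs G. \<exists>!v. (h, v) \<in> att G) \<and>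
     adj G \<subseteq> halfs G \<times> halfs G \<and> sym (adj G) \<and> irrefl (adj G) \<and> single_valued (adj G)"

definition external :: "('v, 'h) hgraph \<Rightarrow> 'h set"
  where "external G = {h \<in> halfs G. \<forall>h'. (h, h') \<notin> adj G}"

definition internal :: "('v, 'h) hgraph \<Rightarrow> 'h set set"
  where "internal G = {{h, h'} | h h'. (h, h') \<in> adj G}"

definition vlink :: "('v, 'h) hgraph \<Rightarrow> ('v \<times> 'v) set"
  where "vlink G = {(v, w). \<exists>h h'. (h, v) \<in> att G \<and> (h', w) \<in> att G \<and> (h, h') \<in> adj G}"

definition full_subgraph :: "('v, 'h) hgraph \<Rightarrow> 'v set \<Rightarrow> ('v, 'h) hgraph"
  where "full_subgraph G U =
     (let H = {h \<in> halfs G. \<exists>v\<in>U. (h, v) \<in> att G}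
      in \<lparr>verts = U, halfs = H, att = att G \<inter> H \<times> U, adj = adj G \<inter> H \<times> H\<rparr>)"

definition components :: "('v, 'h) hgraph \<Rightarrow> ('v, 'h) hgraph set"
  where "components G = {full_subgraph G ((vlink G)\<^sup>* `` {v}) | v. v \<in> verts G}"

text \<open>First Betti number, i.e. the number of independent loops.\<close>

definition loop_number :: "('v, 'h) hgraph \<Rightarrow> int"
  where "loop_number G =
     int (card (internal G)) - int (card (verts G)) + int (card (components G))"

definition feynman :: "('v, 'h) hgraph \<Rightarrow> bool"
  where "feynman G \<longleftrightarrow>
     half_edge_graph G \<and> (\<forall>v\<in>verts G. card {h. (h, v) \<in> att G} = 3) \<and>
     (\<forall>K\<in>components G. card (external K) \<in> {2, 3} \<and> loop_number K \<ge> 1)"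

definition subgraph :: "('v, 'h) hgraph \<Rightarrow> ('v, 'h) hgraph \<Rightarrow> bool"
  where "subgraph g G \<longleftrightarrow>
     feynman g \<and> verts g \<subseteq> verts G \<and> halfs g \<subseteq> halfs G \<and>
     (\<forall>h v. v \<in> verts g \<and> (h, v) \<in> att G \<longrightarrow> h \<in> halfs g) \<and>
     att g = att G \<inter> halfs g \<times> verts g \<and> adj g = adj G \<inter> halfs g \<times> halfs g"

text \<open>
  Quotient by a connected subgraph \<open>K\<close>.  In the last case \<open>K\<close> has two external half-edges \<open>a\<close>,
  \<open>b\<close>.  If only one of them is joined to a half-edge of \<open>G\<close>, that half-edge becomes external.
\<close>

definition quot_connected :: "('v, 'h) hgraph \<Rightarrow> ('v, 'h) hgraph \<Rightarrow> ('v, 'h) hgraph"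
  where "quot_connected G K =
     (let V = verts G - verts K; H = halfs G - halfs K;
          rest = \<lparr>verts = V, halfs = H, att = att G \<inter> H \<times> V, adj = adj G \<inter> H \<times> H\<rparr>
      in if K \<in> components G then rest
         else if card (external K) = 3 then
           (let n = (SOME v. v \<notin> verts G); H' = H \<union> external K
            in \<lparr>verts = insert n V, halfs = H',
                att = att rest \<union> external K \<times> {n}, adj = adj G \<inter> H' \<times> H'\<rparr>)
         else
           rest\<lparr>adj := adj rest \<union>
             {(a', b'). \<exists>a\<in>external K. \<exists>b\<in>external K.
                a \<noteq> b \<and> (a, a') \<in> adj G \<and> (b, b') \<in> adj G}\<rparr>)"

text \<open>
  Successive quotients by the components of \<open>g\<close>, in some order.  Distinct components of a subgraph
  of \<open>G\<close> are not adjacent in \<open>G\<close>, so the order affects only the name of the new vertices.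
\<close>

definition quot_graph :: "('v, 'h) hgraph \<Rightarrow> ('v, 'h) hgraph \<Rightarrow> ('v, 'h) hgraph"
  where "quot_graph G g =
     foldl quot_connected G (SOME Ks. distinct Ks \<and> set Ks = components g)"

definition graph_iso :: "('v, 'h) hgraph \<Rightarrow> ('v, 'h) hgraph \<Rightarrow> bool"
  where "graph_iso G G' \<longleftrightarrow> (\<exists>f g.
     bij_betw f (verts G) (verts G') \<and> bij_betw g (halfs G) (halfs G') \<and>
     (\<forall>h\<in>halfs G. \<forall>v\<in>verts G. (h, v) \<in> att G \<longleftrightarrow> (g h, f v) \<in> att G') \<and>
     (\<forall>h\<in>halfs G. \<forall>h'\<in>halfs G. (h, h') \<in> adj G \<longleftrightarrow> (g h, g h') \<in> adj G'))"

definition LFG :: "(('v::infinite, 'h::infinite) hgraph, ('v, 'h) hgraph) hall_cat"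
  where "LFG = \<lparr>
     Obj = {G. feynman G},
     Isom = graph_iso,
     Zero = \<lparr>verts = {}, halfs = {}, att = {}, adj = {}\<rparr>,
     Disj = (\<lambda>G G'. verts G \<inter> verts G' = {} \<and> halfs G \<inter> halfs G' = {}),
     Plus = (\<lambda>G G'. \<lparr>verts = verts G \<union> verts G', halfs = halfs G \<union> halfs G',
        att = att G \<union> att G', adj = adj G \<union> adj G'\<rparr>),
     Sub = (\<lambda>G. {g. subgraph g G}),
     subob = (\<lambda>G g. g),
     quot = quot_graph\<rparr>"

end

theory Submission
  imports Defs
begin

text \<open>
  The left action of \<open>X\<close> on a functional \<open>m\<close> is \<open>f \<mapsto> m (f \<times> X)\<close>, the transpose of right Hall
  multiplication by \<open>X\<close>.  It preserves \<open>H_below C M\<close> because subobjects of subobjects are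
  subobjects, and at classes where the Hall product is associative it turns the commutator of \<open>X\<close>
  and \<open>Y\<close> into the commutator of their actions.  The bracket is again finitely supported, because
  the sizes of a subobject and its quotient bound the size of the object.
\<close>

section \<open>Top elimination as the transpose of Hall multiplication\<close>

text \<open>The minus sign in the basis formula and the one that turns a right action into a left
  one cancel, so the transpose appears without a sign. Acting by \<open>Y\<close> and then by
  \<open>X\<close> amounts to multiplying the argument by \<open>X\<close> first and by
  \<open>Y\<close> second, and so the commutator comes out in the order of a left module. The
  obstacle is that the Hall product is defined through arbitrary representatives and through cuts or
  subgraphs of these. Isomorphisms between finite objects are therefore extended to permutations of
  the whole label type: an isomorphic object is then literally an image of the other, and passing to
  subobjects commutes with images. For forests, cuts become vertex sets closed under children in one
  fixed digraph; subobject and quotient are the restrictions to such a set and to its complement,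
  and associativity becomes a bijection between pairs of sets. For graphs, associativity stays a
  premise, asked only at the classes below \<open>M\<close>, which are all that an element of
  \<open>H_below C M\<close> can see.\<close>

lemma scl_apply [simp]: "scl c f x = c * f x"
  by (simp add: scl_def)

lemma sum_fun_apply: "(\<Sum>i\<in>I. f i) x = (\<Sum>i\<in>I. f i x)"
  by (induction I rule: infinite_finite_induct) auto

lemma hall_mult_add_right: "hall_mult C f (X + Y) = hall_mult C f X + hall_mult C f Y"
  by (auto simp: hall_mult_def fun_eq_iff algebra_simps sum.distrib)

lemma hall_mult_diff_right: "hall_mult C f (X - Y) = hall_mult C f X - hall_mult C f Y"
  by (auto simp: hall_mult_def fun_eq_iff algebra_simps sum_subtractf)

lemma hall_mult_scl_right: "hall_mult C f (scl c X) = scl c (hall_mult C f X)"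
  by (auto simp: hall_mult_def fun_eq_iff algebra_simps sum_distrib_left)

lemma delta_in_Hall: "A \<in> Iso C \<Longrightarrow> delta A \<in> Hall C"
  by (auto simp: Hall_def delta_def)

lemma hall_prim_subset_Hall: "hall_prim C \<subseteq> Hall C"
  by (auto simp: hall_prim_def)

lemma subspace_Hall: "rat_fun.subspace (Hall C)"
  unfolding rat_fun.subspace_def
proof (intro conjI ballI allI)
  show "0 \<in> Hall C" by (simp add: Hall_def)
next
  fix f g assume fg: "f \<in> Hall C" "g \<in> Hall C"
  have "{A. (f + g) A \<noteq> 0} \<subseteq> {A. f A \<noteq> 0} \<union> {A. g A \<noteq> 0}" by auto
  then show "f + g \<in> Hall C" using fg
    by (auto simp: Hall_def intro: finite_subset)
next
  fix c f assume f: "f \<in> Hall C"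
  have "{A. scl c f A \<noteq> 0} \<subseteq> {A. f A \<noteq> 0}" by auto
  then show "scl c f \<in> Hall C" using f
    by (auto simp: Hall_def intro: finite_subset)
qed

lemma subspace_hall_prim: "rat_fun.subspace (hall_prim C)"
  using subspace_Hall[of C]
  unfolding rat_fun.subspace_def hall_prim_def hall_comult_def
  by (auto simp: algebra_simps)

text \<open>Allowing any finite superset \<open>S\<close> of the support makes the claim inductive:
  adding a multiple of \<open>phi A\<close> can enlarge the support or cancel part of it.\<close>

lemma Hall_dual_expansion:
  assumes "m \<in> Hall_dual C"
  shows "finite {B. m (delta B) \<noteq> 0} \<and> {B. m (delta B) \<noteq> 0} \<subseteq> Iso C \<and>
    (\<forall>S f. finite S \<longrightarrow> {B. m (delta B) \<noteq> 0} \<subseteq> S \<longrightarrow> m f = (\<Sum>B\<in>S. m (delta B) * f B))"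
  using assms unfolding Hall_dual_def
proof (induction rule: rat_fun.span_induct_alt)
  case base
  show ?case by simp
next
  case (step c x y)
  then obtain A where A: "A \<in> Iso C" "x = phi A" by auto
  let ?m = "scl c x + y"
  have xd: "x (delta B) = (if B = A then 1 else 0)" for B
    by (simp add: A phi_def delta_def)
  have sub: "{B. ?m (delta B) \<noteq> 0} \<subseteq> insert A {B. y (delta B) \<noteq> 0}"
    by (simp add: xd subset_iff)
  have "?m f = (\<Sum>B\<in>S. ?m (delta B) * f B)"
    if S: "finite S" "{B. ?m (delta B) \<noteq> 0} \<subseteq> S" for S f
  proof -
    \<comment> \<open>If the coefficients at \<open>A\<close> cancel, \<open>S\<close> may miss
      \<open>A\<close> although \<open>A\<close> is in the support of \<open>y\<close>. The set is
      enlarged so that the induction hypothesis applies.\<close>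
    let ?S = "insert A S \<union> {B. y (delta B) \<noteq> 0}"
    have fin: "finite ?S" using S(1) step by simp
    have "(\<Sum>B\<in>S. ?m (delta B) * f B) = (\<Sum>B\<in>?S. ?m (delta B) * f B)"
      using fin S by (intro sum.mono_neutral_left) auto
    also have "\<dots> = (\<Sum>B\<in>?S. (if B = A then c * f B else 0) + y (delta B) * f B)"
      by (intro sum.cong refl) (simp add: xd algebra_simps)
    also have "\<dots> = c * f A + (\<Sum>B\<in>?S. y (delta B) * f B)"
      using fin by (simp add: sum.distrib)
    also have "(\<Sum>B\<in>?S. y (delta B) * f B) = y f"
      by (rule conjunct2[OF conjunct2[OF step.IH], rule_format, OF fin, symmetric]) auto
    finally show ?thesis by (simp add: A phi_def)
  qed
  moreover have "finite (insert A {B. y (delta B) \<noteq> 0})" "insert A {B. y (delta B) \<noteq> 0} \<subseteq> Iso C"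
    using step A by auto
  ultimately show ?case using sub by (meson finite_subset order_trans)
qed

lemma Hall_dual_support_Iso: "m \<in> Hall_dual C \<Longrightarrow> m (delta B) \<noteq> 0 \<Longrightarrow> B \<in> Iso C"
  using Hall_dual_expansion by blast

lemma Hall_dual_apply:
  "m \<in> Hall_dual C \<Longrightarrow> m f = (\<Sum>B | m (delta B) \<noteq> 0. m (delta B) * f B)"
  using Hall_dual_expansion[of m C] by blast

lemma Hall_dual_add:
  assumes "m \<in> Hall_dual C"
  shows "m (f + g) = m f + m g"
  unfolding Hall_dual_apply[OF assms, of "f + g"] Hall_dual_apply[OF assms, of f]
    Hall_dual_apply[OF assms, of g]
  by (simp add: algebra_simps sum.distrib)

lemma Hall_dual_diff:
  assumes "m \<in> Hall_dual C"
  shows "m (f - g) = m f - m g"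
  unfolding Hall_dual_apply[OF assms, of "f - g"] Hall_dual_apply[OF assms, of f]
    Hall_dual_apply[OF assms, of g]
  by (simp add: algebra_simps sum_subtractf)

lemma Hall_dual_scl:
  assumes "m \<in> Hall_dual C"
  shows "m (scl c f) = c * m f"
  unfolding Hall_dual_apply[OF assms, of "scl c f"] Hall_dual_apply[OF assms, of f]
  by (simp add: algebra_simps sum_distrib_left)

text \<open>The functionals are defined on all functions, whereas associativity is available only on
  \<open>Hall C\<close>. Testing on \<open>delta E\<close>, which lies in \<open>Hall C\<close>,
  bridges the gap.\<close>

lemma Hall_dual_eqI:
  assumes "m \<in> Hall_dual C" "n \<in> Hall_dual C"
    and "\<And>E. E \<in> Iso C \<Longrightarrow> m (delta E) = n (delta E)"
  shows "m = n"
proof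
  fix f
  have "m (delta E) = n (delta E)" for E
    using assms Hall_dual_support_Iso by metis
  then show "m f = n f"
    by (simp add: Hall_dual_apply[OF assms(1), of f] Hall_dual_apply[OF assms(2), of f])
qed

text \<open>Summing over the classes \<open>A\<close> and then over the subobjects with quotient
  \<open>A\<close> is the same as summing over all subobjects, weighted by the value of
  \<open>X\<close> at the quotient.\<close>

lemma left_top_elim_eq:
  assumes m: "m \<in> Hall_dual C" and X: "X \<in> Hall C"
    and fin: "\<And>B. B \<in> Iso C \<Longrightarrow> finite (Sub C (rep B))"
  shows "left_top_elim C X m = (\<lambda>f. m (hall_mult C f X))"
proof
  fix f
  let ?IA = "{A. A \<in> Iso C \<and> X A \<noteq> 0}" and ?IB = "{B. m (delta B) \<noteq> 0}"
  have IB: "{B. B \<in> Iso C \<and> m (delta B) \<noteq> 0} = ?IB"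
    using Hall_dual_support_Iso[OF m] by auto
  have finA: "finite ?IA" using X by (simp add: Hall_def)
  have XIso: "A \<in> Iso C" if "X A \<noteq> 0" for A using X that by (auto simp: Hall_def)
  have *: "- (\<Sum>A\<in>?IA. scl (m (delta B) * X A) (top_elim_basis C B A) f)
      = m (delta B) * hall_mult C f X B" if B: "B \<in> Iso C" for B
  proof -
    let ?S = "Sub C (rep B)"
    let ?s = "\<lambda>N. cls C (subob C (rep B) N)" and ?q = "\<lambda>N. cls C (quot C (rep B) N)"
    have "- (\<Sum>A\<in>?IA. scl (m (delta B) * X A) (top_elim_basis C B A) f)
      = m (delta B) * (\<Sum>A\<in>?IA. \<Sum>N | N \<in> ?S \<and> ?q N = A. X A * f (?s N))"
      by (simp add: top_elim_basis_def sum_fun_apply phi_def sum_negf sum_distrib_left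
          algebra_simps)
    also have "(\<Sum>A\<in>?IA. \<Sum>N | N \<in> ?S \<and> ?q N = A. X A * f (?s N))
      = (\<Sum>A\<in>?IA. \<Sum>N\<in>?S. if ?q N = A then X A * f (?s N) else 0)"
      by (rule sum.cong[OF refl]) (rule sum.inter_filter[OF fin[OF B]])
    also have "\<dots> = (\<Sum>N\<in>?S. \<Sum>A\<in>?IA. if ?q N = A then X A * f (?s N) else 0)"
      by (rule sum.swap)
    \<comment> \<open>Only \<open>A = ?q N\<close> can contribute. If \<open>?q N\<close> is outside
      the range of summation, then \<open>X (?q N)\<close> is 0, because \<open>X\<close> is
      supported on \<open>Iso C\<close>; this covers quotients that are not objects.\<close>
    also have "\<dots> = (\<Sum>N\<in>?S. f (?s N) * X (?q N))"
      using finA XIso by (intro sum.cong refl) auto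
    finally show ?thesis using B by (simp add: hall_mult_def)
  qed
  have "left_top_elim C X m f
    = (\<Sum>B\<in>?IB. - (\<Sum>A\<in>?IA. scl (m (delta B) * X A) (top_elim_basis C B A) f))"
    unfolding left_top_elim_def top_elim_def IB by (simp add: sum_fun_apply sum_negf)
  also have "\<dots> = (\<Sum>B\<in>?IB. m (delta B) * hall_mult C f X B)"
    using * Hall_dual_support_Iso[OF m] by (intro sum.cong refl) auto
  also have "\<dots> = m (hall_mult C f X)"
    by (rule Hall_dual_apply[OF m, symmetric])
  finally show "left_top_elim C X m f = m (hall_mult C f X)" .
qed

section \<open>Finite dimension, stability and the bracket relation\<close>

lemma H_below_subset_Hall_dual: "H_below C M \<subseteq> Hall_dual C"
  unfolding H_below_def Hall_dual_def by (intro rat_fun.span_mono) (auto simp: below_def)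

lemma finite_dim_H_below:
  assumes "finite (Sub C (rep M))"
  shows "finite_dim (H_below C M)"
proof -
  have "below C M \<subseteq> (\<lambda>N. cls C (subob C (rep M) N)) ` Sub C (rep M)"
    by (auto simp: below_def)
  then have "finite (below C M)" using assms by (blast intro: finite_subset)
  then show ?thesis unfolding finite_dim_def H_below_def by blast
qed

text \<open>The transpose sends \<open>phi B\<close> to a linear combination of evaluations at the
  subobjects of \<open>B\<close>, with the values of \<open>X\<close> at the quotients as
  coefficients.\<close>

lemma hall_mult_transpose_H_below:
  assumes m: "m \<in> H_below C M"
    and closed: "\<And>B N. B \<in> below C M \<Longrightarrow> N \<in> Sub C (rep B) \<Longrightarrow>
      cls C (subob C (rep B) N) \<in> below C M"
  shows "(\<lambda>f. m (hall_mult C f X)) \<in> H_below C M"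
  using m unfolding H_below_def
proof (induction rule: rat_fun.span_induct_alt)
  case base
  have "(\<lambda>f. (0 :: ('a set \<Rightarrow> rat) \<Rightarrow> rat) (hall_mult C f X)) = 0" by (simp add: fun_eq_iff)
  then show ?case by (simp only: rat_fun.span_zero)
next
  case (step c x y)
  then obtain B where B: "B \<in> below C M" "x = phi B" by auto
  have BI: "B \<in> Iso C" using B by (simp add: below_def)
  have "(\<lambda>f. x (hall_mult C f X)) =
    (\<Sum>N\<in>Sub C (rep B). scl (X (cls C (quot C (rep B) N))) (phi (cls C (subob C (rep B) N))))"
    using BI by (auto simp: B phi_def hall_mult_def sum_fun_apply algebra_simps)
  also have "\<dots> \<in> rat_fun.span (phi ` below C M)"
    by (intro rat_fun.span_sum rat_fun.span_scale rat_fun.span_base imageI closed B)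
  finally have "(\<lambda>f. x (hall_mult C f X)) \<in> rat_fun.span (phi ` below C M)" .
  note rat_fun.span_add[OF rat_fun.span_scale[OF this, of c] step.IH]
  also have "scl c (\<lambda>f. x (hall_mult C f X)) + (\<lambda>f. y (hall_mult C f X))
    = (\<lambda>f. (scl c x + y) (hall_mult C f X))"
    by (simp add: fun_eq_iff)
  finally show ?case .
qed

lemma stable_action_H_below:
  assumes fin: "\<And>B. B \<in> Iso C \<Longrightarrow> finite (Sub C (rep B))"
    and closed: "\<And>B N. B \<in> below C M \<Longrightarrow> N \<in> Sub C (rep B) \<Longrightarrow>
      cls C (subob C (rep B) N) \<in> below C M"
  shows "stable_action (hall_prim C) (H_below C M) (left_top_elim C)"
proof -
  have dual: "m \<in> Hall_dual C" if "m \<in> H_below C M" for m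
    using that H_below_subset_Hall_dual by blast
  have act: "left_top_elim C X m = (\<lambda>f. m (hall_mult C f X))"
    if "X \<in> hall_prim C" "m \<in> H_below C M" for X m
    using left_top_elim_eq[OF dual[OF that(2)] _ fin] that hall_prim_subset_Hall by blast
  have sW: "rat_fun.subspace (H_below C M)"
    unfolding H_below_def by (rule rat_fun.subspace_span)
  note closures = rat_fun.subspace_add[OF sW] rat_fun.subspace_scale[OF sW]
    rat_fun.subspace_add[OF subspace_hall_prim] rat_fun.subspace_scale[OF subspace_hall_prim]
  show ?thesis
    unfolding stable_action_def
    by (auto simp: act closures subspace_hall_prim sW hall_mult_add_right hall_mult_scl_right
        Hall_dual_add[OF dual] Hall_dual_scl[OF dual] fun_eq_iff
        hall_mult_transpose_H_below[OF _ closed])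
qed

text \<open>This confines the associativity requirement to the classes below \<open>M\<close>: both
  sides of the associative law are inserted into the same functional \<open>m\<close>.\<close>

lemma H_below_cong:
  assumes "m \<in> H_below C M" "\<And>E. E \<in> below C M \<Longrightarrow> f E = g E"
  shows "m f = m g"
  using assms(1) unfolding H_below_def
  by (induction rule: rat_fun.span_induct_alt) (auto simp: phi_def assms(2))

text \<open>Acting by \<open>Y\<close> and then by \<open>X\<close> sends \<open>m\<close> to the
  functional whose value at \<open>f\<close> is \<open>m\<close> at
  \<open>(f \<times> X) \<times> Y\<close>. Associativity moves the bracketing to
  \<open>f \<times> (X \<times> Y)\<close>, and the difference with \<open>X\<close> and
  \<open>Y\<close> exchanged is the action of the bracket.\<close>

lemma lie_module_H_below:
  assumes fin: "\<And>B. B \<in> Iso C \<Longrightarrow> finite (Sub C (rep B))"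
    and closed: "\<And>B N. B \<in> below C M \<Longrightarrow> N \<in> Sub C (rep B) \<Longrightarrow>
      cls C (subob C (rep B) N) \<in> below C M"
    and mult: "\<And>f g. f \<in> Hall C \<Longrightarrow> g \<in> Hall C \<Longrightarrow> hall_mult C f g \<in> Hall C"
    and assoc: "\<And>E. E \<in> below C M \<Longrightarrow> hall_assoc_at C E"
  shows "lie_module (hall_prim C) (hall_bracket C) (H_below C M) (left_top_elim C)"
  unfolding lie_module_def
proof (intro conjI ballI)
  show "stable_action (hall_prim C) (H_below C M) (left_top_elim C)"
    by (rule stable_action_H_below[OF fin closed])
next
  fix X Y m
  assume "X \<in> hall_prim C" "Y \<in> hall_prim C" and m: "m \<in> H_below C M"
  then have X: "X \<in> Hall C" and Y: "Y \<in> Hall C" using hall_prim_subset_Hall by blast+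
  have dual: "n \<in> Hall_dual C" if "n \<in> H_below C M" for n
    using that H_below_subset_Hall_dual by blast
  have act: "left_top_elim C Z n = (\<lambda>f. n (hall_mult C f Z))"
    if "Z \<in> Hall C" "n \<in> H_below C M" for Z n
    using left_top_elim_eq[OF dual[OF that(2)] that(1) fin] .
  have actW: "left_top_elim C Z n \<in> H_below C M" if "Z \<in> Hall C" "n \<in> H_below C M" for Z n
    unfolding act[OF that] by (rule hall_mult_transpose_H_below[OF that(2) closed])
  have br: "hall_bracket C X Y \<in> Hall C"
    unfolding hall_bracket_def by (intro rat_fun.subspace_diff[OF subspace_Hall] mult X Y)
  show "left_top_elim C (hall_bracket C X Y) m =
    left_top_elim C X (left_top_elim C Y m) - left_top_elim C Y (left_top_elim C X m)"
    (is "?l = ?r")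
  proof (rule Hall_dual_eqI)
    show "?l \<in> Hall_dual C" by (intro dual actW br m)
    have "?r \<in> H_below C M"
      using actW X Y m unfolding H_below_def by (intro rat_fun.span_diff) auto
    then show "?r \<in> Hall_dual C" by (rule dual)
  next
    fix E assume "E \<in> Iso C"
    then have E: "delta E \<in> Hall C" by (rule delta_in_Hall)
    have *: "m (hall_mult C (hall_mult C (delta E) U) V) = m (hall_mult C (delta E) (hall_mult C U V))"
      if "U \<in> Hall C" "V \<in> Hall C" for U V
      using assoc E that by (intro H_below_cong[OF m]) (auto simp: hall_assoc_at_def)
    show "?l (delta E) = ?r (delta E)"
      using X Y m br actW *
      by (simp add: act hall_bracket_def hall_mult_diff_right Hall_dual_diff[OF dual])
  qed
qed

section \<open>Isomorphism classes\<close>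

text \<open>
  Quotients in \<open>LFG\<close> need not be Feynman graphs, whereas \<open>forest_iso\<close> is an equivalence relation
  only on rooted forests.  Hence isomorphism is required to be an equivalence on a set \<open>U\<close> between
  the objects and the whole type.
\<close>

definition iso_equiv :: "'o set \<Rightarrow> ('o, 'n) hall_cat \<Rightarrow> bool"
  where "iso_equiv U C \<longleftrightarrow> Obj C \<subseteq> U \<and>
    reflp_on U (Isom C) \<and> symp_on U (Isom C) \<and> transp_on U (Isom C)"

lemma cls_eqI:
  assumes eq: "iso_equiv U C" and "x \<in> U" "y \<in> U" "Isom C x y"
  shows "cls C x = cls C y"
proof -
  have "Isom C y x" using assms by (auto simp: iso_equiv_def dest: symp_onD)
  have "Isom C x z \<longleftrightarrow> Isom C y z" if "z \<in> Obj C" for z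
  proof -
    have "z \<in> U" using that eq by (auto simp: iso_equiv_def)
    then show ?thesis using assms \<open>Isom C y x\<close> unfolding iso_equiv_def by (metis transp_onD)
  qed
  then show ?thesis unfolding cls_def by auto
qed

lemma rep_in_cls:
  assumes "iso_equiv U C" "cls C x \<in> Iso C"
  shows "rep (cls C x) \<in> cls C x"
proof -
  obtain y where "y \<in> Obj C" "cls C x = cls C y" using assms(2) by (auto simp: Iso_def)
  then have "y \<in> cls C x"
    using assms(1) by (auto simp: cls_def iso_equiv_def dest: reflp_onD)
  then show ?thesis unfolding rep_def by (rule someI)
qed

lemma Isom_rep_cls: "iso_equiv U C \<Longrightarrow> cls C x \<in> Iso C \<Longrightarrow> Isom C x (rep (cls C x))"
  using rep_in_cls[of U C x] by (simp add: cls_def)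

lemma rep_in_Obj: "iso_equiv U C \<Longrightarrow> M \<in> Iso C \<Longrightarrow> rep M \<in> Obj C"
  using rep_in_cls[of U C] by (auto simp: cls_def Iso_def)

lemma cls_in_Iso: "x \<in> Obj C \<Longrightarrow> cls C x \<in> Iso C"
  by (simp add: Iso_def)

lemma cls_rep:
  assumes "iso_equiv U C" "M \<in> Iso C"
  shows "cls C (rep M) = M"
proof -
  obtain x where x: "x \<in> Obj C" "M = cls C x" using assms(2) by (auto simp: Iso_def)
  have "cls C x = cls C (rep M)"
    using x assms(1) Isom_rep_cls[OF assms(1), of x] rep_in_Obj[OF assms]
    by (intro cls_eqI[OF assms(1)]) (auto simp: iso_equiv_def Iso_def)
  then show ?thesis using x by simp
qed

text \<open>\<open>rep B\<close> is an arbitrary representative, only isomorphic to the subobject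
  \<open>K\<close> of \<open>rep M\<close>. A subobject of it is carried to one of \<open>K\<close>
  by \<open>transport\<close> and becomes a subobject of \<open>rep M\<close> by
  \<open>trans\<close>.\<close>

lemma below_closed:
  assumes eq: "iso_equiv U C"
    and obj: "\<And>x N. x \<in> Obj C \<Longrightarrow> N \<in> Sub C x \<Longrightarrow> subob C x N \<in> Obj C"
    and transport: "\<And>x y N. x \<in> Obj C \<Longrightarrow> y \<in> Obj C \<Longrightarrow> Isom C x y \<Longrightarrow> N \<in> Sub C x \<Longrightarrow>
      \<exists>N'\<in>Sub C y. Isom C (subob C x N) (subob C y N')"
    and trans: "\<And>x N N'. x \<in> Obj C \<Longrightarrow> N \<in> Sub C x \<Longrightarrow> N' \<in> Sub C (subob C x N) \<Longrightarrow>
      \<exists>N''\<in>Sub C x. subob C (subob C x N) N' = subob C x N''"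
    and M: "M \<in> Iso C" and B: "B \<in> below C M" and N: "N \<in> Sub C (rep B)"
  shows "cls C (subob C (rep B) N) \<in> below C M"
proof -
  obtain K where K: "K \<in> Sub C (rep M)" "B = cls C (subob C (rep M) K)" and BI: "B \<in> Iso C"
    using B by (auto simp: below_def)
  have U: "x \<in> U" if "x \<in> Obj C" for x using eq that by (auto simp: iso_equiv_def)
  have M': "rep M \<in> Obj C" and B': "rep B \<in> Obj C" using M BI eq by (auto intro: rep_in_Obj)
  have K': "subob C (rep M) K \<in> Obj C" by (rule obj[OF M' K(1)])
  have "Isom C (subob C (rep M) K) (rep B)" using Isom_rep_cls[OF eq] BI K by metis
  then have "Isom C (rep B) (subob C (rep M) K)"
    using eq U[OF B'] U[OF K'] by (auto simp: iso_equiv_def dest: symp_onD)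
  then obtain N' where N': "N' \<in> Sub C (subob C (rep M) K)"
    "Isom C (subob C (rep B) N) (subob C (subob C (rep M) K) N')"
    using transport[OF B' K' _ N] by blast
  have "cls C (subob C (rep B) N) = cls C (subob C (subob C (rep M) K) N')"
    by (intro cls_eqI[OF eq _ _ N'(2)] U obj B' N K' N'(1))
  moreover obtain N'' where
    "N'' \<in> Sub C (rep M)" "subob C (subob C (rep M) K) N' = subob C (rep M) N''"
    using trans[OF M' K(1) N'(1)] by blast
  ultimately show ?thesis
    using cls_in_Iso[OF obj[OF B' N]] by (auto simp: below_def)
qed

text \<open>The inequality \<open>size_sub\<close> is asked only for quotients whose class lies in
  \<open>Iso C\<close>: at any other quotient \<open>g\<close> vanishes, and the summand is
  0.\<close>

lemma hall_mult_in_Hall: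
  fixes size :: "'o \<Rightarrow> nat"
  assumes eq: "iso_equiv U C"
    and subquot: "\<And>x N. x \<in> Obj C \<Longrightarrow> N \<in> Sub C x \<Longrightarrow> subob C x N \<in> U \<and> quot C x N \<in> U"
    and size_iso: "\<And>x y. x \<in> U \<Longrightarrow> y \<in> U \<Longrightarrow> Isom C x y \<Longrightarrow> size x = size y"
    and size_sub: "\<And>x N. x \<in> Obj C \<Longrightarrow> N \<in> Sub C x \<Longrightarrow> cls C (quot C x N) \<in> Iso C \<Longrightarrow>
      size x \<le> size (subob C x N) + size (quot C x N)"
    and size_fin: "\<And>n. finite (cls C ` {x \<in> Obj C. size x \<le> n})"
    and f: "f \<in> Hall C" and g: "g \<in> Hall C"
  shows "hall_mult C f g \<in> Hall C"
proof -
  \<comment> \<open>The sum of the sizes over the finite support is a crude bound for their maximum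
    that also makes sense for empty support.\<close>
  let ?b = "\<lambda>h :: 'o set \<Rightarrow> rat. \<Sum>A | h A \<noteq> 0. size (rep A)"
  have size_le: "size x \<le> ?b h" if "x \<in> U" "h \<in> Hall C" "h (cls C x) \<noteq> 0" for x h
  proof -
    have c: "cls C x \<in> Iso C" using that by (auto simp: Hall_def)
    then have "rep (cls C x) \<in> U" using rep_in_Obj[OF eq] eq by (auto simp: iso_equiv_def)
    then have "size x = size (rep (cls C x))" using c that(1) by (intro size_iso Isom_rep_cls[OF eq])
    also have "\<dots> \<le> ?b h"
      using that by (intro member_le_sum) (auto simp: Hall_def)
    finally show ?thesis .
  qed
  have "{M. hall_mult C f g M \<noteq> 0} \<subseteq> cls C ` {x \<in> Obj C. size x \<le> ?b f + ?b g}"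
  proof
    fix M assume "M \<in> {M. hall_mult C f g M \<noteq> 0}"
    then have M: "M \<in> Iso C" and
      "(\<Sum>N\<in>Sub C (rep M). f (cls C (subob C (rep M) N)) * g (cls C (quot C (rep M) N))) \<noteq> 0"
      by (auto simp: hall_mult_def split: if_splits)
    then obtain N where N: "N \<in> Sub C (rep M)"
      "f (cls C (subob C (rep M) N)) \<noteq> 0" "g (cls C (quot C (rep M) N)) \<noteq> 0"
      by (force elim!: sum.not_neutral_contains_not_neutral)
    have "cls C (quot C (rep M) N) \<in> Iso C" using N g by (auto simp: Hall_def)
    then have "size (rep M) \<le> ?b f + ?b g"
      using size_sub[OF rep_in_Obj[OF eq M] N(1)] subquot[OF rep_in_Obj[OF eq M] N(1)]
        size_le[OF _ f N(2)] size_le[OF _ g N(3)] by linarith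
    then show "M \<in> cls C ` {x \<in> Obj C. size x \<le> ?b f + ?b g}"
      by (intro image_eqI[of _ _ "rep M"])
        (use rep_in_Obj[OF eq M] cls_rep[OF eq M] in simp_all)
  qed
  then have "finite {M. hall_mult C f g M \<noteq> 0}" using size_fin by (rule finite_subset)
  moreover have "{M. hall_mult C f g M \<noteq> 0} \<subseteq> Iso C" by (auto simp: hall_mult_def)
  ultimately show ?thesis by (simp add: Hall_def)
qed

section \<open>Injections and permutations\<close>

text \<open>\<open>A - B\<close> and \<open>B - A\<close> have the same number of elements, so
  \<open>f\<close> can be completed by a bijection from \<open>B - A\<close> onto
  \<open>A - B\<close> and by the identity elsewhere. In this way an isomorphism of finite objects
  becomes a relabeling by a permutation of all labels.\<close>

lemma bij_extension:
  fixes f :: "'a \<Rightarrow> 'a"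
  assumes "finite A" "bij_betw f A B"
  obtains p where "bij p" "\<And>x. x \<in> A \<Longrightarrow> p x = f x"
proof -
  have B: "finite B" "card B = card A"
    using assms bij_betw_finite bij_betw_same_card by metis+
  have "card (B - A) = card (A - B)"
    using assms(1) B by (metis Int_commute card_Diff_subset_Int finite_Int)
  then obtain h where h: "bij_betw h (B - A) (A - B)"
    using finite_same_card_bij[of "B - A" "A - B"] assms B by auto
  define p where "p x = (if x \<in> A then f x else if x \<in> B then h x else x)" for x
  have 1: "bij_betw p A B"
    using assms(2) by (rule bij_betw_cong[THEN iffD1, rotated]) (simp add: p_def)
  have 2: "bij_betw p (B - A) (A - B)"
    using h by (rule bij_betw_cong[THEN iffD1, rotated]) (simp add: p_def)
  have 3: "bij_betw p (- (A \<union> B)) (- (A \<union> B))"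
    using bij_betw_id by (rule bij_betw_cong[THEN iffD1, rotated]) (simp add: p_def)
  have "bij_betw p (A \<union> (B - A) \<union> - (A \<union> B)) (B \<union> (A - B) \<union> - (A \<union> B))"
    by (intro bij_betw_combine 1 2 3) auto
  moreover have "A \<union> (B - A) \<union> - (A \<union> B) = UNIV" "B \<union> (A - B) \<union> - (A \<union> B) = UNIV" by auto
  ultimately show ?thesis using that[of p] by (auto simp: p_def)
qed

text \<open>Relabels every object of bounded size into one fixed finite label set, which leaves only
  finitely many isomorphism classes of that size.\<close>

lemma bij_into:
  assumes "finite A" "finite W" "card A \<le> card W"
  obtains p :: "'a \<Rightarrow> 'a" where "bij p" "p ` A \<subseteq> W"
proof -
  obtain W' where "W' \<subseteq> W" "card W' = card A" "finite W'"
    using assms obtain_subset_with_card_n by (metis finite_subset)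
  moreover then obtain f where f: "bij_betw f A W'"
    using assms(1) finite_same_card_bij by metis
  moreover obtain p where "bij p" "\<And>x. x \<in> A \<Longrightarrow> p x = f x"
    using bij_extension[OF assms(1) f] by metis
  ultimately show ?thesis using that[of p] by (force simp: bij_betw_def)
qed

lemma mem_map_prod_image:
  "inj p \<Longrightarrow> inj q \<Longrightarrow> (p x, q y) \<in> map_prod p q ` E \<longleftrightarrow> (x, y) \<in> E"
  by (auto simp: inj_eq)

lemma rtrancl_map_prod_image:
  assumes p: "inj p"
  shows "(map_prod p p ` E)\<^sup>* `` {p r} = p ` (E\<^sup>* `` {r})"
proof (intro equalityI subsetI)
  fix x assume "x \<in> (map_prod p p ` E)\<^sup>* `` {p r}"
  then have "(p r, x) \<in> (map_prod p p ` E)\<^sup>*" by simp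
  then show "x \<in> p ` (E\<^sup>* `` {r})"
  proof (induction rule: rtrancl_induct)
    case (step y z)
    from step.IH obtain v where "y = p v" "(r, v) \<in> E\<^sup>*" by auto
    moreover from step.hyps obtain a b where "y = p a" "z = p b" "(a, b) \<in> E" by auto
    ultimately show ?case using p by (auto simp: inj_eq intro: rtrancl_into_rtrancl)
  qed auto
next
  fix x assume "x \<in> p ` (E\<^sup>* `` {r})"
  then obtain v where x: "x = p v" and "(r, v) \<in> E\<^sup>*" by auto
  from this(2) have "(p r, p v) \<in> (map_prod p p ` E)\<^sup>*"
  proof (induction rule: rtrancl_induct)
    case (step y z)
    then have "(p y, p z) \<in> map_prod p p ` E" by auto
    with step show ?case by (meson rtrancl.rtrancl_into_rtrancl)
  qed auto
  then show "x \<in> (map_prod p p ` E)\<^sup>* `` {p r}" by (simp add: x)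
qed

lemma map_prod_image_Int:
  assumes "inj p" "inj q"
  shows "map_prod p q ` E \<inter> p ` A \<times> q ` B = map_prod p q ` (E \<inter> A \<times> B)"
  using assms by (auto simp: inj_eq)

section \<open>Rooted forests as digraphs\<close>

text \<open>
  A labeled rooted forest is the same as a finite acyclic digraph in which every vertex has at most
  one parent.  In these terms a cut of the forest is a set of vertices that is closed under
  children: the set of vertices below the cut.
\<close>

definition tree_at :: "('s \<times> 's) set \<Rightarrow> 's \<Rightarrow> 's rtree"
  where "tree_at E r = \<lparr>tverts = E\<^sup>* `` {r}, tedges = E \<inter> (E\<^sup>* `` {r}) \<times> (E\<^sup>* `` {r}), troot = r\<rparr>"

definition forest_of :: "'s set \<Rightarrow> ('s \<times> 's) set \<Rightarrow> 's rtree set"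
  where "forest_of V E = tree_at E ` (V - Range E)"

definition forestlike :: "'s set \<Rightarrow> ('s \<times> 's) set \<Rightarrow> bool"
  where "forestlike V E \<longleftrightarrow> finite V \<and> E \<subseteq> V \<times> V \<and> single_valued (E\<inverse>) \<and> acyclic E"

definition fverts :: "'s rtree set \<Rightarrow> 's set"
  where "fverts F = (\<Union>T\<in>F. tverts T)"

definition fedges :: "'s rtree set \<Rightarrow> ('s \<times> 's) set"
  where "fedges F = (\<Union>T\<in>F. tedges T)"

definition down_sets :: "'s set \<Rightarrow> ('s \<times> 's) set \<Rightarrow> 's set set"
  where "down_sets V E = {D. D \<subseteq> V \<and> E `` D \<subseteq> D}"

lemma branch_eq: "branch T C r = tree_at (tedges T - C) r"
  by (auto simp: branch_def tree_at_def Let_def)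

lemma forestlike_restrict: "forestlike V E \<Longrightarrow> D \<subseteq> V \<Longrightarrow> forestlike D (E \<inter> D \<times> D)"
  unfolding forestlike_def single_valued_def
  by (auto intro: finite_subset acyclic_subset)

lemma forestlike_wf: "forestlike V E \<Longrightarrow> wf E"
  and forestlike_wf_converse: "forestlike V E \<Longrightarrow> wf (E\<inverse>)"
  unfolding forestlike_def
  by (meson finite_SigmaI finite_acyclic_wf finite_acyclic_wf_converse finite_subset)+

text \<open>No edge joins \<open>D\<close> to its complement, so a path that starts in
  \<open>D\<close> never leaves it. The edges that remain after a cut have this form, and so do
  those of a disjoint union.\<close>

lemma rtrancl_Un_disjoint:
  assumes "E1 \<subseteq> D \<times> D" "E2 \<subseteq> (- D) \<times> (- D)" "r \<in> D"
  shows "(E1 \<union> E2)\<^sup>* `` {r} = E1\<^sup>* `` {r}" "E1\<^sup>* `` {r} \<subseteq> D"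
proof -
  have *: "(r, v) \<in> E1\<^sup>* \<and> v \<in> D" if "(r, v) \<in> (E1 \<union> E2)\<^sup>*" for v
    using that
  proof (induction rule: rtrancl_induct)
    case base
    show ?case using assms by simp
  next
    case (step y z)
    then show ?case using assms by (auto intro: rtrancl_into_rtrancl)
  qed
  have "(r, v) \<in> (E1 \<union> E2)\<^sup>*" if "(r, v) \<in> E1\<^sup>*" for v
    using that by (meson Un_upper1 rtrancl_mono subsetD)
  with * show "(E1 \<union> E2)\<^sup>* `` {r} = E1\<^sup>* `` {r}" "E1\<^sup>* `` {r} \<subseteq> D" by auto
qed

lemma tree_at_Un_disjoint:
  assumes "E1 \<subseteq> D \<times> D" "E2 \<subseteq> (- D) \<times> (- D)" "r \<in> D"
  shows "tree_at (E1 \<union> E2) r = tree_at E1 r"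
  using rtrancl_Un_disjoint[OF assms] assms by (auto simp: tree_at_def)

lemma forest_of_UN:
  assumes "\<And>i. i \<in> I \<Longrightarrow> E i \<subseteq> V i \<times> V i"
    and "\<And>i j. i \<in> I \<Longrightarrow> j \<in> I \<Longrightarrow> i \<noteq> j \<Longrightarrow> V i \<inter> V j = {}"
  shows "forest_of (\<Union>i\<in>I. V i) (\<Union>i\<in>I. E i) = (\<Union>i\<in>I. forest_of (V i) (E i))"
proof -
  have tr: "tree_at (\<Union>i\<in>I. E i) r = tree_at (E i) r" if "i \<in> I" "r \<in> V i" for i r
  proof -
    have "(\<Union>j\<in>I - {i}. E j) \<subseteq> (- V i) \<times> (- V i)" using assms that(1) by fast
    from tree_at_Un_disjoint[OF assms(1)[OF that(1)] this that(2)]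
    show ?thesis using that(1) by (metis UN_insert insert_Diff)
  qed
  have ro: "r \<in> Range (\<Union>i\<in>I. E i) \<longleftrightarrow> r \<in> Range (E i)" if "i \<in> I" "r \<in> V i" for i r
  proof -
    have "j = i" if "(u, r) \<in> E j" "j \<in> I" for j u
      using that \<open>i \<in> I\<close> \<open>r \<in> V i\<close> assms by blast
    then show ?thesis using that by auto
  qed
  have "V i - Range (\<Union>i\<in>I. E i) = V i - Range (E i)" if "i \<in> I" for i
    by (rule set_eqI) (metis Diff_iff ro that)
  then have "(\<Union>i\<in>I. V i - Range (\<Union>i\<in>I. E i)) = (\<Union>i\<in>I. V i - Range (E i))"
    by (rule SUP_cong[OF refl])
  moreover have "(\<Union>i\<in>I. V i) - R = (\<Union>i\<in>I. V i - R)" for R by blast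
  ultimately have "(\<Union>i\<in>I. V i) - Range (\<Union>i\<in>I. E i) = (\<Union>i\<in>I. V i - Range (E i))"
    by (simp only:)
  then show ?thesis unfolding forest_of_def image_UN
    by (simp only: image_UN) (rule SUP_cong[OF refl], rule image_cong[OF refl], simp add: tr)
qed

text \<open>Acyclicity is not part of \<open>rooted_tree\<close>, but follows from unique parents: a
  cycle through a vertex also passes through its parent, hence by induction through the root, which
  has no parent.\<close>

lemma rooted_tree_forestlike:
  assumes "rooted_tree T"
  shows "forestlike (tverts T) (tedges T)"
proof -
  let ?E = "tedges T"
  have E: "?E \<subseteq> tverts T \<times> tverts T" and nr: "\<And>u. (u, troot T) \<notin> ?E"
    and uniq: "\<And>v. v \<in> tverts T - {troot T} \<Longrightarrow> \<exists>!u. (u, v) \<in> ?E"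
    and reach: "\<And>v. v \<in> tverts T \<Longrightarrow> (troot T, v) \<in> ?E\<^sup>*"
    using assms unfolding rooted_tree_def by auto
  have par: "u = u'" if "(u, v) \<in> ?E" "(u', v) \<in> ?E" for u u' v
    using that E nr uniq[of v] by blast
  have acyc: "(v, v) \<notin> ?E\<^sup>+" if "(troot T, v) \<in> ?E\<^sup>*" for v
    using that
  proof (induction rule: rtrancl_induct)
    case base
    show ?case using nr by (auto elim: tranclE)
  next
    case (step y z)
    show ?case
    proof
      assume "(z, z) \<in> ?E\<^sup>+"
      then obtain w where "(z, w) \<in> ?E\<^sup>*" "(w, z) \<in> ?E" by (meson tranclD2)
      with step par have "(y, y) \<in> ?E\<^sup>+" by (metis rtrancl_into_trancl2)
      with step show False by simp
    qed
  qed
  have "acyclic ?E"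
    unfolding acyclic_def
  proof (intro allI notI)
    fix x assume x: "(x, x) \<in> ?E\<^sup>+"
    then have "x \<in> tverts T" using E by (meson mem_Sigma_iff subsetD tranclD)
    then show False using acyc reach x by blast
  qed
  then show ?thesis using assms E par
    by (auto simp: forestlike_def rooted_tree_def single_valued_def)
qed

lemma forest_of_rooted_tree:
  assumes T: "rooted_tree T"
  shows "forest_of (tverts T) (tedges T) = {T}"
proof -
  let ?E = "tedges T"
  have E: "?E \<subseteq> tverts T \<times> tverts T" using T unfolding rooted_tree_def by simp
  have "?E\<^sup>* `` {troot T} = tverts T"
  proof (intro equalityI subsetI)
    fix v assume "v \<in> ?E\<^sup>* `` {troot T}"
    then have "(troot T, v) \<in> ?E\<^sup>*" by simp
    then show "v \<in> tverts T"
      using T E by (induction rule: rtrancl_induct) (auto simp: rooted_tree_def)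
  qed (use T in \<open>auto simp: rooted_tree_def\<close>)
  then have "tree_at ?E (troot T) = T" using E by (cases T) (auto simp: tree_at_def)
  moreover have "tverts T - Range ?E = {troot T}"
    using T by (fastforce simp: rooted_tree_def)
  ultimately show ?thesis by (simp add: forest_of_def)
qed

lemma rooted_forest_edges:
  assumes "rooted_forest F" "T \<in> F"
  shows "rooted_tree T" "tedges T \<subseteq> tverts T \<times> tverts T"
  using assms unfolding rooted_forest_def rooted_tree_def by auto

lemma rooted_forest_disjoint:
  "rooted_forest F \<Longrightarrow> T \<in> F \<Longrightarrow> T' \<in> F \<Longrightarrow> T \<noteq> T' \<Longrightarrow> tverts T \<inter> tverts T' = {}"
  unfolding rooted_forest_def by auto

lemma forest_of_rooted_forest:
  assumes "rooted_forest F"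
  shows "forest_of (fverts F) (fedges F) = F"
proof -
  have "forest_of (fverts F) (fedges F) = (\<Union>T\<in>F. forest_of (tverts T) (tedges T))"
    unfolding fverts_def fedges_def using assms
    by (intro forest_of_UN) (auto dest: rooted_forest_edges rooted_forest_disjoint)
  also have "\<dots> = (\<Union>T\<in>F. {T})"
    using assms by (intro SUP_cong refl forest_of_rooted_tree) (rule rooted_forest_edges)
  finally show ?thesis by simp
qed

lemma rooted_forest_forestlike:
  assumes F: "rooted_forest F"
  shows "forestlike (fverts F) (fedges F)"
  unfolding forestlike_def
proof (intro conjI)
  have fl: "forestlike (tverts T) (tedges T)" if "T \<in> F" for T
    using rooted_tree_forestlike rooted_forest_edges[OF F that] by blast
  show "finite (fverts F)" using F fl by (auto simp: fverts_def rooted_forest_def forestlike_def)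
  show "fedges F \<subseteq> fverts F \<times> fverts F"
    using rooted_forest_edges[OF F] by (fastforce simp: fverts_def fedges_def)
  have same: "T = T'" if "T \<in> F" "T' \<in> F" "v \<in> tverts T" "v \<in> tverts T'" for T T' v
    using rooted_forest_disjoint[OF F] that by blast
  show "single_valued ((fedges F)\<inverse>)"
  proof (rule single_valuedI)
    fix x y z assume "(x, y) \<in> (fedges F)\<inverse>" "(x, z) \<in> (fedges F)\<inverse>"
    then obtain T T' where T: "T \<in> F" "T' \<in> F" "(y, x) \<in> tedges T" "(z, x) \<in> tedges T'"
      by (auto simp: fedges_def)
    then have "T = T'" using same rooted_forest_edges(2)[OF F] by blast
    then show "y = z" using T fl[of T] by (auto simp: forestlike_def single_valued_def)
  qed
  show "acyclic (fedges F)"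
    unfolding acyclic_def
  proof (intro allI notI)
    fix x assume x: "(x, x) \<in> (fedges F)\<^sup>+"
    then obtain y where y: "(x, y) \<in> fedges F" "(y, x) \<in> (fedges F)\<^sup>*" by (meson tranclD)
    then obtain T where T: "T \<in> F" "(x, y) \<in> tedges T" by (auto simp: fedges_def)
    \<comment> \<open>A path cannot change trees: consecutive edges share a vertex, and the vertex
      sets of different trees are disjoint.\<close>
    have "(y, z) \<in> (tedges T)\<^sup>* \<and> z \<in> tverts T" if "(y, z) \<in> (fedges F)\<^sup>*" for z
      using that
    proof (induction rule: rtrancl_induct)
      case base
      then show ?case using T rooted_forest_edges(2)[OF F] by blast
    next
      case (step u v)
      then obtain T' where T': "T' \<in> F" "(u, v) \<in> tedges T'" by (auto simp: fedges_def)
      then have "T' = T" using same step T rooted_forest_edges(2)[OF F] by blast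
      then show ?case using T' step rooted_forest_edges(2)[OF F T'(1)]
        by (auto intro: rtrancl_into_rtrancl)
    qed
    then have "(x, x) \<in> (tedges T)\<^sup>+" using T y by (meson rtrancl_into_trancl2)
    then show False using fl[OF T(1)] by (auto simp: forestlike_def acyclic_def)
  qed
qed

text \<open>Climbing from \<open>v\<close> through unique parents is deterministic, so all ancestors
  of \<open>v\<close> lie on one chain.\<close>

lemma forestlike_comparable:
  assumes "forestlike V E" "(u, v) \<in> E\<^sup>*" "(w, v) \<in> E\<^sup>*"
  shows "(u, w) \<in> E\<^sup>* \<or> (w, u) \<in> E\<^sup>*"
  using single_valued_confluent[of "E\<inverse>" v u w] assms
  by (auto simp: forestlike_def rtrancl_converse)

lemma forestlike_root:
  assumes "forestlike V E" "v \<in> V"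
  obtains r where "r \<in> V - Range E" "(r, v) \<in> E\<^sup>*"
proof -
  have "\<exists>r. r \<in> V - Range E \<and> (r, v) \<in> E\<^sup>*"
    using forestlike_wf[OF assms(1)] assms(2)
  proof (induction v rule: wf_induct_rule)
    case (less v)
    show ?case
    proof (cases "v \<in> Range E")
      case True
      then obtain u where u: "(u, v) \<in> E" by auto
      then have "u \<in> V" using assms(1) by (auto simp: forestlike_def)
      then show ?thesis using less(1)[OF u] u by (meson rtrancl.rtrancl_into_rtrancl)
    qed (use less in auto)
  qed
  then show ?thesis using that by blast
qed

lemma rtrancl_to_root: "(v, r) \<in> E\<^sup>* \<Longrightarrow> r \<notin> Range E \<Longrightarrow> v = r"
  by (auto elim: rtranclE)

lemma rooted_tree_tree_at:
  assumes fl: "forestlike V E" and r: "r \<in> V - Range E"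
  shows "rooted_tree (tree_at E r)" "tverts (tree_at E r) \<subseteq> V"
proof -
  let ?R = "E\<^sup>* `` {r}"
  have sub: "?R \<subseteq> V"
  proof
    fix v assume "v \<in> ?R"
    then have "(r, v) \<in> E\<^sup>*" by simp
    then show "v \<in> V" using fl r
      by (induction rule: rtrancl_induct) (auto simp: forestlike_def)
  qed
  then show "tverts (tree_at E r) \<subseteq> V" by (simp add: tree_at_def)
  have reach: "(r, v) \<in> (E \<inter> ?R \<times> ?R)\<^sup>*" if "(r, v) \<in> E\<^sup>*" for v
    using that
  proof (induction rule: rtrancl_induct)
    case (step y z)
    then have "(y, z) \<in> E \<inter> ?R \<times> ?R" by (auto intro: rtrancl_into_rtrancl)
    then show ?case using step by (meson rtrancl.rtrancl_into_rtrancl)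
  qed simp
  have "\<exists>!u. (u, v) \<in> E \<inter> ?R \<times> ?R" if v: "(r, v) \<in> E\<^sup>*" "v \<noteq> r" for v
  proof -
    obtain u where "(r, u) \<in> E\<^sup>*" "(u, v) \<in> E" using v by (auto elim: rtranclE)
    then show ?thesis using fl by (auto simp: forestlike_def single_valued_def)
  qed
  moreover have "finite ?R" using sub fl finite_subset by (auto simp: forestlike_def)
  ultimately show "rooted_tree (tree_at E r)"
    using reach r unfolding rooted_tree_def tree_at_def by auto
qed

text \<open>Together with \<open>forest_of_rooted_forest\<close> this makes \<open>forest_of\<close>
  and the pair of \<open>fverts\<close> and \<open>fedges\<close> mutually inverse, so that
  statements about forests can be proved for digraphs.\<close>

lemma rooted_forest_forest_of:
  assumes fl: "forestlike V E"
  shows "rooted_forest (forest_of V E)"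
    "fverts (forest_of V E) = V" "fedges (forest_of V E) = E"
proof -
  have "tverts (tree_at E r) \<inter> tverts (tree_at E r') = {}"
    if "r \<in> V - Range E" "r' \<in> V - Range E" "tree_at E r \<noteq> tree_at E r'" for r r'
  proof (rule ccontr)
    assume "\<not> ?thesis"
    \<comment> \<open>A common vertex makes the two roots comparable, and a root has no ancestor but
      itself.\<close>
    then obtain v where "(r, v) \<in> E\<^sup>*" "(r', v) \<in> E\<^sup>*" by (auto simp: tree_at_def)
    then have "(r, r') \<in> E\<^sup>* \<or> (r', r) \<in> E\<^sup>*" by (rule forestlike_comparable[OF fl])
    then have "r = r'" using that rtrancl_to_root by (metis DiffD2)
    then show False using that by simp
  qed
  then show "rooted_forest (forest_of V E)"
    using fl rooted_tree_tree_at(1)[OF fl]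
    by (fastforce simp: rooted_forest_def forest_of_def forestlike_def)
  show V: "fverts (forest_of V E) = V"
  proof
    show "fverts (forest_of V E) \<subseteq> V"
      using rooted_tree_tree_at(2)[OF fl] by (fastforce simp: fverts_def forest_of_def)
    show "V \<subseteq> fverts (forest_of V E)"
    proof
      fix v assume "v \<in> V"
      then obtain r where "r \<in> V - Range E" "(r, v) \<in> E\<^sup>*" by (rule forestlike_root[OF fl])
      then show "v \<in> fverts (forest_of V E)" by (auto simp: fverts_def forest_of_def tree_at_def)
    qed
  qed
  show "fedges (forest_of V E) = E"
  proof
    show "fedges (forest_of V E) \<subseteq> E" by (auto simp: fedges_def forest_of_def tree_at_def)
    show "E \<subseteq> fedges (forest_of V E)"
    proof
      fix e assume e: "e \<in> E"
      obtain u v where uv: "e = (u, v)" by (cases e)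
      then have "u \<in> V" using e fl by (auto simp: forestlike_def)
      then obtain r where "r \<in> V - Range E" "(r, u) \<in> E\<^sup>*" by (rule forestlike_root[OF fl])
      moreover then have "(r, v) \<in> E\<^sup>*" using e uv by (auto intro: rtrancl_into_rtrancl)
      ultimately show "e \<in> fedges (forest_of V E)"
        using e uv by (auto simp: fedges_def forest_of_def tree_at_def)
    qed
  qed
qed

section \<open>Cuts as sets of vertices\<close>

definition crossing :: "('s \<times> 's) set \<Rightarrow> 's set \<Rightarrow> ('s \<times> 's) set"
  where "crossing E D = {(u, v) \<in> E. u \<notin> D \<and> v \<in> D}"

text \<open>No edge crosses into \<open>D\<close> both when \<open>D\<close> is empty and when it is
  the whole tree. The test on the root tells the null cut from the full cut.\<close>

definition tree_cut :: "'s rtree \<Rightarrow> 's set \<Rightarrow> 's cut"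
  where "tree_cut T D = (if troot T \<in> D then Full_Cut else Edge_Cut (crossing (tedges T) D))"

lemma down_setsD: "D \<in> down_sets V E \<Longrightarrow> u \<in> D \<Longrightarrow> (u, v) \<in> E \<Longrightarrow> v \<in> D"
  by (auto simp: down_sets_def)

lemma down_sets_rtrancl: "D \<in> down_sets V E \<Longrightarrow> (u, v) \<in> E\<^sup>* \<Longrightarrow> u \<in> D \<Longrightarrow> v \<in> D"
  by (rotate_tac, induction rule: rtrancl_induct) (auto dest: down_setsD)

lemma down_set_with_root:
  assumes "rooted_tree T" "D \<in> down_sets (tverts T) (tedges T)" "troot T \<in> D"
  shows "D = tverts T"
  using assms down_sets_rtrancl[OF assms(2)] by (auto simp: rooted_tree_def down_sets_def)

text \<open>The path from the root to a vertex of \<open>D\<close> starts outside \<open>D\<close>,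
  enters through a crossing edge and then stays inside. So \<open>D\<close> can be recovered from
  its crossing edges, which gives injectivity of \<open>tree_cut\<close>.\<close>

lemma down_set_crossing:
  assumes T: "rooted_tree T" and D: "D \<in> down_sets (tverts T) (tedges T)" and r: "troot T \<notin> D"
  shows "D = (tedges T)\<^sup>* `` snd ` crossing (tedges T) D"
proof
  show "(tedges T)\<^sup>* `` snd ` crossing (tedges T) D \<subseteq> D"
    using down_sets_rtrancl[OF D] by (auto simp: crossing_def)
  show "D \<subseteq> (tedges T)\<^sup>* `` snd ` crossing (tedges T) D"
  proof
    fix v assume v: "v \<in> D"
    then have "(troot T, v) \<in> (tedges T)\<^sup>*" using T D by (auto simp: rooted_tree_def down_sets_def)
    then show "v \<in> (tedges T)\<^sup>* `` snd ` crossing (tedges T) D" using v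
    proof (induction rule: rtrancl_induct)
      case base
      then show ?case using r by simp
    next
      case (step y z)
      show ?case
      proof (cases "y \<in> D")
        case True
        then show ?thesis using step by (auto intro: rtrancl_into_rtrancl)
      next
        case False
        then have "(y, z) \<in> crossing (tedges T) D" using step by (simp add: crossing_def)
        then show ?thesis by force
      qed
    qed
  qed
qed

lemma rooted_tree_parent:
  assumes "rooted_tree T" "v \<in> tverts T" "v \<noteq> troot T"
  obtains u where "(u, v) \<in> tedges T"
  using assms unfolding rooted_tree_def by blast

text \<open>Admissibility constrains only paths that end in leaves. A leaf below the lower of two
  nested cut edges puts both on such a path.\<close>

lemma leaf_below:
  assumes "rooted_tree T" "v \<in> tverts T"
  obtains l where "leaf T l" "(v, l) \<in> (tedges T)\<^sup>*"
proof -
  have E: "tedges T \<subseteq> tverts T \<times> tverts T" using assms(1) by (simp add: rooted_tree_def)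
  have "\<exists>l. leaf T l \<and> (v, l) \<in> (tedges T)\<^sup>*"
    using forestlike_wf_converse[OF rooted_tree_forestlike[OF assms(1)]] assms(2)
  proof (induction v rule: wf_induct_rule)
    case (less v)
    show ?case
    proof (cases "leaf T v")
      case False
      then obtain w where w: "(v, w) \<in> tedges T" using less(2) by (auto simp: leaf_def)
      then show ?thesis using less(1)[of w] E by (auto intro: converse_rtrancl_into_rtrancl)
    qed auto
  qed
  then show ?thesis using that by blast
qed

text \<open>Replaces the cardinality bound by the statement that any two cut edges above one leaf
  agree. This rests on finiteness of the edge set, since \<open>card\<close> is 0 on infinite
  sets.\<close>

lemma admissible_iff:
  assumes "rooted_tree T"
  shows "admissible T C \<longleftrightarrow> C \<subseteq> tedges T \<and>
    (\<forall>l u v u' v'. leaf T l \<longrightarrow> (u, v) \<in> C \<longrightarrow> (u', v') \<in> C \<longrightarrow> (v, l) \<in> (tedges T)\<^sup>* \<longrightarrow>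
      (v', l) \<in> (tedges T)\<^sup>* \<longrightarrow> u = u' \<and> v = v')"
proof -
  have "finite (tedges T)" using assms by (auto simp: rooted_tree_def intro: finite_subset)
  then have "finite (C \<inter> root_path T l)" for l
    by (rule finite_subset[rotated]) (auto simp: root_path_def)
  then have "card (C \<inter> root_path T l) \<le> 1 \<longleftrightarrow>
      (\<forall>e\<in>C \<inter> root_path T l. \<forall>e'\<in>C \<inter> root_path T l. e = e')" for l
    by (simp add: card_le_Suc0_iff_eq)
  moreover have "C \<inter> root_path T l = {(u, v) \<in> C. (v, l) \<in> (tedges T)\<^sup>*}" if "C \<subseteq> tedges T" for l
    using that by (auto simp: root_path_def)
  ultimately have "card (C \<inter> root_path T l) \<le> 1 \<longleftrightarrow> (\<forall>e\<in>{(u, v) \<in> C. (v, l) \<in> (tedges T)\<^sup>*}.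
      \<forall>e'\<in>{(u, v) \<in> C. (v, l) \<in> (tedges T)\<^sup>*}. e = e')" if "C \<subseteq> tedges T" for l
    using that by (simp only:)
  then have "admissible T C \<longleftrightarrow> C \<subseteq> tedges T \<and>
    (\<forall>l. leaf T l \<longrightarrow> (\<forall>e\<in>{(u, v) \<in> C. (v, l) \<in> (tedges T)\<^sup>*}.
      \<forall>e'\<in>{(u, v) \<in> C. (v, l) \<in> (tedges T)\<^sup>*}. e = e'))"
    unfolding admissible_def by (intro conj_cong refl) (simp only:)
  then show ?thesis
    unfolding Ball_def mem_Collect_eq split_paired_All prod.case prod.inject by blast
qed

text \<open>Two crossing edges above one leaf have comparable lower ends. If these differ, the upper
  end of the lower edge is reachable from a vertex of \<open>D\<close> and hence lies in
  \<open>D\<close>, which a crossing edge forbids.\<close>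

lemma admissible_crossing:
  assumes T: "rooted_tree T" and D: "D \<in> down_sets (tverts T) (tedges T)"
  shows "admissible T (crossing (tedges T) D)"
proof -
  let ?E = "tedges T"
  have fl: "forestlike (tverts T) ?E" by (rule rooted_tree_forestlike[OF T])
  have *: "u = u' \<and> v = v'"
    if c: "(u, v) \<in> crossing ?E D" "(u', v') \<in> crossing ?E D" and vv: "(v, v') \<in> ?E\<^sup>*" for u v u' v'
  proof (cases "v = v'")
    case True
    then show ?thesis using c fl by (auto simp: crossing_def forestlike_def single_valued_def)
  next
    case False
    then obtain w where w: "(v, w) \<in> ?E\<^sup>*" "(w, v') \<in> ?E" using vv by (meson rtranclE)
    then have "w = u'" using c fl by (auto simp: crossing_def forestlike_def single_valued_def)
    then show ?thesis using down_sets_rtrancl[OF D w(1)] c by (auto simp: crossing_def)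
  qed
  have "u = u' \<and> v = v'"
    if "(u, v) \<in> crossing ?E D" "(u', v') \<in> crossing ?E D" "(v, l) \<in> ?E\<^sup>*" "(v', l) \<in> ?E\<^sup>*"
    for u v u' v' l
    using forestlike_comparable[OF fl that(3,4)] *[OF that(1,2)] *[OF that(2,1)] by blast
  moreover have "crossing ?E D \<subseteq> ?E" by (auto simp: crossing_def)
  ultimately show ?thesis unfolding admissible_iff[OF T] by blast
qed

text \<open>Inverts \<open>tree_cut\<close> on edge cuts, with \<open>D\<close> the set of all
  vertices below a cut edge. Unique parents make every crossing edge a cut edge, and admissibility
  keeps the upper end of a cut edge out of \<open>D\<close>.\<close>

lemma admissible_eq_crossing:
  assumes T: "rooted_tree T" and C: "admissible T C"
  defines "D \<equiv> (tedges T)\<^sup>* `` snd ` C"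
  shows "D \<in> down_sets (tverts T) (tedges T)" "troot T \<notin> D" "crossing (tedges T) D = C"
proof -
  let ?E = "tedges T"
  have fl: "forestlike (tverts T) ?E" by (rule rooted_tree_forestlike[OF T])
  have E: "?E \<subseteq> tverts T \<times> tverts T" and nr: "troot T \<notin> Range ?E"
    using T by (auto simp: rooted_tree_def)
  have CE: "C \<subseteq> ?E" and adm: "\<And>l u v u' v'. leaf T l \<Longrightarrow> (u, v) \<in> C \<Longrightarrow> (u', v') \<in> C \<Longrightarrow>
      (v, l) \<in> ?E\<^sup>* \<Longrightarrow> (v', l) \<in> ?E\<^sup>* \<Longrightarrow> u = u' \<and> v = v'"
    using C unfolding admissible_iff[OF T] by blast+
  have "v \<in> tverts T" if "(w, v) \<in> ?E\<^sup>*" "w \<in> tverts T" for w v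
    using that E by (induction rule: rtrancl_induct) auto
  then have "D \<subseteq> tverts T" using CE E by (fastforce simp: D_def)
  then show "D \<in> down_sets (tverts T) ?E"
    by (auto simp: down_sets_def D_def intro: rtrancl_into_rtrancl)
  show "troot T \<notin> D"
    using CE nr by (auto simp: D_def dest!: rtrancl_to_root)
  show "crossing ?E D = C"
  proof (intro equalityI subsetI)
    fix e assume "e \<in> crossing ?E D"
    then obtain u v x w where uv: "e = (u, v)" "(u, v) \<in> ?E" "u \<notin> D"
      and xw: "(x, w) \<in> C" "(w, v) \<in> ?E\<^sup>*"
      by (auto simp: crossing_def D_def)
    show "e \<in> C"
    proof (cases "w = v")
      case True
      then have "x = u" using xw uv CE fl by (auto simp: forestlike_def single_valued_def)
      then show ?thesis using True xw uv by simp
    next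
      case False
      then obtain y where "(w, y) \<in> ?E\<^sup>*" "(y, v) \<in> ?E" using xw by (meson rtranclE)
      then have "(w, u) \<in> ?E\<^sup>*" using uv fl by (auto simp: forestlike_def single_valued_def)
      then show ?thesis using xw uv by (force simp: D_def)
    qed
  next
    fix e assume e: "e \<in> C"
    obtain u v where uv: "e = (u, v)" by (cases e)
    have "u \<notin> D"
    proof
      assume "u \<in> D"
      then obtain x w where xw: "(x, w) \<in> C" "(w, u) \<in> ?E\<^sup>*" by (auto simp: D_def)
      have uvE: "(u, v) \<in> ?E" using e uv CE by auto
      \<comment> \<open>This leaf lies below both \<open>(x, w)\<close> and \<open>(u, v)\<close>,
        so the two cut edges share their lower end, and then \<open>v\<close> lies on a
        cycle.\<close>
      obtain l where l: "leaf T l" "(v, l) \<in> ?E\<^sup>*" using leaf_below[OF T] uvE E by blast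
      then have "(w, l) \<in> ?E\<^sup>*" using xw uvE by (meson rtrancl.rtrancl_into_rtrancl rtrancl_trans)
      then have "w = v" using adm[OF l(1) xw(1) _ _ l(2)] e uv by blast
      then have "(v, v) \<in> ?E\<^sup>+" using xw uvE by (meson rtrancl_into_trancl1)
      then show False using fl by (auto simp: forestlike_def acyclic_def)
    qed
    moreover have "v \<in> D" using e uv by (force simp: D_def)
    ultimately show "e \<in> crossing ?E D" using e uv CE by (auto simp: crossing_def)
  qed
qed

lemma bij_betw_tree_cut:
  assumes T: "rooted_tree T"
  shows "bij_betw (tree_cut T) (down_sets (tverts T) (tedges T)) (cuts T)"
  unfolding bij_betw_def
proof
  show "inj_on (tree_cut T) (down_sets (tverts T) (tedges T))"
  proof (rule inj_onI)
    fix D D'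
    assume D: "D \<in> down_sets (tverts T) (tedges T)" and D': "D' \<in> down_sets (tverts T) (tedges T)"
      and eq: "tree_cut T D = tree_cut T D'"
    show "D = D'"
    proof (cases "troot T \<in> D")
      case True
      then have "troot T \<in> D'" using eq by (auto simp: tree_cut_def split: if_splits)
      then show ?thesis using True down_set_with_root[OF T] D D' by metis
    next
      case False
      then have "troot T \<notin> D'" "crossing (tedges T) D = crossing (tedges T) D'"
        using eq by (auto simp: tree_cut_def split: if_splits)
      then show ?thesis using False down_set_crossing[OF T] D D' by metis
    qed
  qed
  show "tree_cut T ` down_sets (tverts T) (tedges T) = cuts T"
  proof (intro equalityI subsetI)
    fix c assume "c \<in> tree_cut T ` down_sets (tverts T) (tedges T)"
    then show "c \<in> cuts T" using admissible_crossing[OF T] by (auto simp: tree_cut_def cuts_def)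
  next
    fix c assume "c \<in> cuts T"
    then consider "c = Full_Cut" | C where "admissible T C" "c = Edge_Cut C"
      by (auto simp: cuts_def)
    then show "c \<in> tree_cut T ` down_sets (tverts T) (tedges T)"
    proof cases
      case 1
      then have "c = tree_cut T (tverts T)" using T by (simp add: tree_cut_def rooted_tree_def)
      moreover have "tverts T \<in> down_sets (tverts T) (tedges T)"
        using T by (auto simp: down_sets_def rooted_tree_def)
      ultimately show ?thesis by blast
    next
      case 2
      then show ?thesis using admissible_eq_crossing[OF T 2(1)]
        by (metis (no_types, lifting) image_eqI tree_cut_def)
    qed
  qed
qed

text \<open>Without the crossing edges, the remaining edges run inside \<open>D\<close> or inside
  its complement. If the root is not in \<open>D\<close>, every vertex of \<open>D\<close> has a
  parent, so the parentless vertices of the restriction to \<open>D\<close> are the lower ends of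
  the crossing edges.\<close>

lemma cut_P_tree_cut:
  assumes T: "rooted_tree T" and D: "D \<in> down_sets (tverts T) (tedges T)"
  shows "cut_P T (tree_cut T D) = forest_of D (tedges T \<inter> D \<times> D)"
proof (cases "troot T \<in> D")
  case True
  then have "D = tverts T" by (rule down_set_with_root[OF T D])
  moreover have "tedges T \<inter> tverts T \<times> tverts T = tedges T" using T by (auto simp: rooted_tree_def)
  ultimately show ?thesis using True forest_of_rooted_tree[OF T] by (simp add: tree_cut_def)
next
  case False
  let ?E = "tedges T" and ?C = "crossing (tedges T) D"
  have split: "?E - ?C = (?E \<inter> D \<times> D) \<union> (?E \<inter> (- D) \<times> (- D))"
    using down_setsD[OF D] by (auto simp: crossing_def)
  have tr: "tree_at (?E - ?C) v = tree_at (?E \<inter> D \<times> D) v" if "v \<in> D" for v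
    unfolding split by (rule tree_at_Un_disjoint[OF _ _ that]) auto
  have roots: "snd ` ?C = D - Range (?E \<inter> D \<times> D)"
  proof (intro equalityI subsetI)
    fix v assume "v \<in> snd ` ?C"
    then obtain u where u: "u \<notin> D" "v \<in> D" "(u, v) \<in> ?E" by (auto simp: crossing_def)
    have "u' = u" if "(u', v) \<in> ?E" for u'
      using rooted_tree_forestlike[OF T] that u(3) by (auto simp: forestlike_def single_valued_def)
    then have "(u', v) \<notin> ?E \<inter> D \<times> D" for u' using u by blast
    then show "v \<in> D - Range (?E \<inter> D \<times> D)" using u by blast
  next
    fix v assume v: "v \<in> D - Range (?E \<inter> D \<times> D)"
    then have "v \<noteq> troot T" "v \<in> tverts T" using False D by (auto simp: down_sets_def)
    then obtain u where "(u, v) \<in> ?E" using rooted_tree_parent[OF T] by blast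
    then have "(u, v) \<in> ?C" using v by (auto simp: crossing_def)
    then show "v \<in> snd ` ?C" by force
  qed
  have "cut_P T (tree_cut T D) = tree_at (?E - ?C) ` snd ` ?C"
    using False by (force simp: tree_cut_def branch_eq)
  also have "\<dots> = tree_at (?E \<inter> D \<times> D) ` snd ` ?C"
    using tr by (intro image_cong) (auto simp: crossing_def)
  finally show ?thesis by (simp add: roots forest_of_def)
qed

lemma cut_R_tree_cut:
  assumes T: "rooted_tree T" and D: "D \<in> down_sets (tverts T) (tedges T)"
  shows "cut_R T (tree_cut T D) =
    forest_of (tverts T - D) (tedges T \<inter> (tverts T - D) \<times> (tverts T - D))"
proof (cases "troot T \<in> D")
  case True
  then have "D = tverts T" by (rule down_set_with_root[OF T D])
  then show ?thesis using True by (simp add: tree_cut_def forest_of_def)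
next
  case False
  let ?E = "tedges T" and ?C = "crossing (tedges T) D" and ?W = "tverts T - D"
  have E: "?E \<subseteq> tverts T \<times> tverts T" using T by (simp add: rooted_tree_def)
  have split: "?E - ?C = (?E \<inter> ?W \<times> ?W) \<union> (?E \<inter> D \<times> D)"
    using down_setsD[OF D] E by (auto simp: crossing_def)
  have r: "troot T \<in> ?W" using False T by (auto simp: rooted_tree_def)
  have "tree_at (?E - ?C) (troot T) = tree_at (?E \<inter> ?W \<times> ?W) (troot T)"
    unfolding split by (rule tree_at_Un_disjoint[OF _ _ r]) auto
  \<comment> \<open>The part above the cut is a single tree: the parent of a vertex outside
    \<open>D\<close> is outside \<open>D\<close> as well, so only the root is parentless
    there.\<close>
  moreover have "?W - Range (?E \<inter> ?W \<times> ?W) = {troot T}"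
  proof (intro equalityI subsetI)
    fix v assume v: "v \<in> ?W - Range (?E \<inter> ?W \<times> ?W)"
    show "v \<in> {troot T}"
    proof (rule ccontr)
      assume "v \<notin> {troot T}"
      then obtain u where "(u, v) \<in> ?E" using rooted_tree_parent[OF T] v by blast
      moreover then have "u \<in> ?W" using v E down_setsD[OF D] by auto
      ultimately show False using v by auto
    qed
  qed (use T r in \<open>auto simp: rooted_tree_def\<close>)
  ultimately show ?thesis using False by (simp add: tree_cut_def branch_eq forest_of_def)
qed

text \<open>The restricted abstraction makes the result \<open>undefined\<close> off
  \<open>F\<close>, as the extensional function space \<open>PiE F cuts\<close> demands.\<close>

definition forest_cut :: "'s rtree set \<Rightarrow> 's set \<Rightarrow> 's rtree \<Rightarrow> 's cut"
  where "forest_cut F D = (\<lambda>T\<in>F. tree_cut T (D \<inter> tverts T))"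

lemma down_sets_tree:
  assumes "rooted_forest F" "D \<in> down_sets (fverts F) (fedges F)" "T \<in> F"
  shows "D \<inter> tverts T \<in> down_sets (tverts T) (tedges T)"
  using assms rooted_forest_edges(2)[OF assms(1,3)]
  by (fastforce simp: down_sets_def fverts_def fedges_def)

lemma bij_betw_forest_cut:
  assumes F: "rooted_forest F"
  shows "bij_betw (forest_cut F) (down_sets (fverts F) (fedges F)) (PiE F cuts)"
  unfolding bij_betw_def
proof
  let ?S = "down_sets (fverts F) (fedges F)"
  note bij = bij_betw_tree_cut[OF rooted_forest_edges(1)[OF F]]
  show "inj_on (forest_cut F) ?S"
  proof (rule inj_onI)
    fix D D' assume D: "D \<in> ?S" "D' \<in> ?S" and eq: "forest_cut F D = forest_cut F D'"
    have "D \<inter> tverts T = D' \<inter> tverts T" if T: "T \<in> F" for T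
    proof -
      have "tree_cut T (D \<inter> tverts T) = tree_cut T (D' \<inter> tverts T)"
        using fun_cong[OF eq, of T] T by (simp add: forest_cut_def)
      then show ?thesis
        using bij[OF T] D down_sets_tree[OF F _ T] unfolding bij_betw_def inj_on_def by blast
    qed
    moreover have "D \<subseteq> fverts F" "D' \<subseteq> fverts F" using D by (auto simp: down_sets_def)
    ultimately show "D = D'" by (fastforce simp: fverts_def)
  qed
  show "forest_cut F ` ?S = PiE F cuts"
  proof (intro equalityI subsetI)
    fix c assume "c \<in> forest_cut F ` ?S"
    then show "c \<in> PiE F cuts"
      using bij_betwE[OF bij] down_sets_tree[OF F] by (auto simp: forest_cut_def)
  next
    fix c assume c: "c \<in> PiE F cuts"
    have "\<exists>D. D \<in> down_sets (tverts T) (tedges T) \<and> tree_cut T D = c T" if "T \<in> F" for T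
      using bij[OF that] c that unfolding bij_betw_def by (metis PiE_mem imageE)
    then obtain D where D: "\<And>T. T \<in> F \<Longrightarrow> D T \<in> down_sets (tverts T) (tedges T)"
      "\<And>T. T \<in> F \<Longrightarrow> tree_cut T (D T) = c T"
      by metis
    let ?D = "\<Union>T\<in>F. D T"
    have sub: "D T \<subseteq> tverts T" if "T \<in> F" for T using D(1)[OF that] by (simp add: down_sets_def)
    have int: "?D \<inter> tverts T = D T" if "T \<in> F" for T
      using sub rooted_forest_disjoint[OF F] that by blast
    have "?D \<in> ?S"
      unfolding down_sets_def
    proof (safe)
      fix v T assume "T \<in> F" "v \<in> D T"
      then show "v \<in> fverts F" using sub by (auto simp: fverts_def)
    next
      fix u v T assume u: "T \<in> F" "u \<in> D T" and "(u, v) \<in> fedges F"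
      then obtain T' where T': "T' \<in> F" "(u, v) \<in> tedges T'" by (auto simp: fedges_def)
      then have "u \<in> D T'" using int u rooted_forest_edges(2)[OF F T'(1)] by blast
      then show "v \<in> ?D" using down_setsD[OF D(1)[OF T'(1)]] T' by blast
    qed
    moreover have "forest_cut F ?D = c"
    proof
      fix T show "forest_cut F ?D T = c T"
        using int D(2) c by (cases "T \<in> F") (auto simp: forest_cut_def PiE_def extensional_def)
    qed
    ultimately show "c \<in> forest_cut F ` ?S" by blast
  qed
qed

lemma subob_quot_forest_cut:
  assumes F: "rooted_forest F" and D: "D \<in> down_sets (fverts F) (fedges F)"
  shows "subob LRF F (forest_cut F D) = forest_of D (fedges F \<inter> D \<times> D)"
    "quot LRF F (forest_cut F D) =
      forest_of (fverts F - D) (fedges F \<inter> (fverts F - D) \<times> (fverts F - D))"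
proof -
  have DV: "D \<subseteq> fverts F" using D by (simp add: down_sets_def)
  \<comment> \<open>One identity serves both claims: \<open>A\<close> is \<open>D\<close> for the
    subobject and \<open>- D\<close> for the quotient.\<close>
  have restrict: "(\<Union>T\<in>F. forest_of (tverts T \<inter> A) (tedges T \<inter> (tverts T \<inter> A) \<times> (tverts T \<inter> A)))
    = forest_of (fverts F \<inter> A) (fedges F \<inter> (fverts F \<inter> A) \<times> (fverts F \<inter> A))" (is "?l = ?r") for A
  proof -
    have "(\<Union>T\<in>F. tverts T \<inter> A) = fverts F \<inter> A" by (auto simp: fverts_def)
    moreover have "(\<Union>T\<in>F. tedges T \<inter> (tverts T \<inter> A) \<times> (tverts T \<inter> A))
      = fedges F \<inter> (fverts F \<inter> A) \<times> (fverts F \<inter> A)"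
      using rooted_forest_edges(2)[OF F] by (fastforce simp: fverts_def fedges_def)
    moreover have "?l = forest_of (\<Union>T\<in>F. tverts T \<inter> A)
        (\<Union>T\<in>F. tedges T \<inter> (tverts T \<inter> A) \<times> (tverts T \<inter> A))"
      using rooted_forest_disjoint[OF F] by (intro forest_of_UN[symmetric]) blast+
    ultimately show ?thesis by simp
  qed
  have "subob LRF F (forest_cut F D) = (\<Union>T\<in>F. cut_P T (tree_cut T (D \<inter> tverts T)))"
    by (simp add: LRF_def forest_cut_def)
  also have "\<dots> = (\<Union>T\<in>F. forest_of (tverts T \<inter> D) (tedges T \<inter> (tverts T \<inter> D) \<times> (tverts T \<inter> D)))"
    using cut_P_tree_cut[OF rooted_forest_edges(1)[OF F] down_sets_tree[OF F D]]
    by (simp add: Int_commute)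
  also have "\<dots> = forest_of D (fedges F \<inter> D \<times> D)"
    unfolding restrict using DV by (simp add: Int_absorb1)
  finally show "subob LRF F (forest_cut F D) = forest_of D (fedges F \<inter> D \<times> D)" .
  have "quot LRF F (forest_cut F D) = (\<Union>T\<in>F. cut_R T (tree_cut T (D \<inter> tverts T)))"
    by (simp add: LRF_def forest_cut_def)
  also have "\<dots> = (\<Union>T\<in>F. forest_of (tverts T \<inter> - D) (tedges T \<inter> (tverts T \<inter> - D) \<times> (tverts T \<inter> - D)))"
  proof (intro SUP_cong refl)
    fix T assume T: "T \<in> F"
    have "tverts T - D \<inter> tverts T = tverts T \<inter> - D" by auto
    with cut_R_tree_cut[OF rooted_forest_edges(1)[OF F T] down_sets_tree[OF F D T]]
    show "cut_R T (tree_cut T (D \<inter> tverts T)) =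
      forest_of (tverts T \<inter> - D) (tedges T \<inter> (tverts T \<inter> - D) \<times> (tverts T \<inter> - D))" by simp
  qed
  finally show "quot LRF F (forest_cut F D) =
      forest_of (fverts F - D) (fedges F \<inter> (fverts F - D) \<times> (fverts F - D))"
    unfolding restrict by (simp add: Diff_eq)
qed

section \<open>The Hall algebra of rooted forests\<close>

definition image_tree :: "('s \<Rightarrow> 's) \<Rightarrow> 's rtree \<Rightarrow> 's rtree"
  where "image_tree p T =
    \<lparr>tverts = p ` tverts T, tedges = map_prod p p ` tedges T, troot = p (troot T)\<rparr>"

lemma forest_of_image:
  assumes p: "inj p"
  shows "forest_of (p ` V) (map_prod p p ` E) = image_tree p ` forest_of V E"
proof -
  have "tree_at (map_prod p p ` E) (p r) = image_tree p (tree_at E r)" for r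
    by (simp add: tree_at_def image_tree_def rtrancl_map_prod_image[OF p]
        map_prod_image_Int[OF p p])
  moreover have "Range (map_prod p p ` E) = p ` Range E" by force
  then have "p ` V - Range (map_prod p p ` E) = p ` (V - Range E)"
    using p by (simp add: image_set_diff)
  ultimately show ?thesis by (simp add: forest_of_def image_image)
qed

lemma inj_image_tree: "inj p \<Longrightarrow> inj (image_tree p)"
proof (rule injI)
  fix T T' assume p: "inj p" and eq: "image_tree p T = image_tree p T'"
  have "inj (map_prod p p)" using p by (simp add: prod.inj_map)
  with p eq show "T = T'"
    by (cases T; cases T') (auto simp: image_tree_def inj_image_eq_iff inj_eq)
qed

lemma forest_iso_image:
  assumes p: "inj p"
  shows "forest_iso (forest_of V E) (forest_of (p ` V) (map_prod p p ` E))"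
  unfolding forest_of_image[OF p] forest_iso_def
proof (intro exI[of _ "image_tree p"] conjI ballI)
  show "bij_betw (image_tree p) (forest_of V E) (image_tree p ` forest_of V E)"
    using inj_image_tree[OF p] by (meson bij_betw_imageI inj_on_subset subset_UNIV)
  fix T show "tree_iso T (image_tree p T)"
    unfolding tree_iso_def image_tree_def using p
    by (intro exI[of _ p])
      (auto simp: mem_map_prod_image intro!: bij_betw_imageI inj_on_subset[OF p])
qed

text \<open>The isomorphisms of the single trees are glued, unambiguously since distinct trees of
  \<open>F\<close> are disjoint and injectively since those of \<open>F'\<close> are. The result is
  then extended to a permutation of all labels.\<close>

lemma forest_iso_imp:
  assumes F: "rooted_forest F" and F': "rooted_forest F'" and iso: "forest_iso F F'"
  obtains p where "bij p" "fverts F' = p ` fverts F" "fedges F' = map_prod p p ` fedges F"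
proof -
  obtain s where s: "bij_betw s F F'" "\<And>T. T \<in> F \<Longrightarrow> tree_iso T (s T)"
    using iso by (auto simp: forest_iso_def)
  have "\<exists>f. bij_betw f (tverts T) (tverts (s T)) \<and>
     (\<forall>u\<in>tverts T. \<forall>v\<in>tverts T. (u, v) \<in> tedges T \<longleftrightarrow> (f u, f v) \<in> tedges (s T))"
    if "T \<in> F" for T
    using s(2)[OF that] unfolding tree_iso_def by blast
  then obtain f where f: "\<And>T. T \<in> F \<Longrightarrow> bij_betw (f T) (tverts T) (tverts (s T))"
    "\<And>T u v. T \<in> F \<Longrightarrow> u \<in> tverts T \<Longrightarrow> v \<in> tverts T \<Longrightarrow>
      (u, v) \<in> tedges T \<longleftrightarrow> (f T u, f T v) \<in> tedges (s T)"
    by metis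
  define tr where "tr v = (SOME T. T \<in> F \<and> v \<in> tverts T)" for v
  have tr: "tr v = T" if "T \<in> F" "v \<in> tverts T" for T v
    unfolding tr_def using that rooted_forest_disjoint[OF F] by (intro some_equality) blast+
  define q where "q v = f (tr v) v" for v
  have q: "q v = f T v" if "T \<in> F" "v \<in> tverts T" for T v
    using tr[OF that] by (simp add: q_def)
  have qT: "q ` tverts T = tverts (s T)" if "T \<in> F" for T
    using f(1)[OF that] q[OF that] by (simp add: bij_betw_def)
  have sF: "s ` F = F'" "inj_on s F" using s(1) by (auto simp: bij_betw_def)
  have img: "q ` fverts F = fverts F'"
    using qT sF(1) by (auto simp: fverts_def image_UN)
  have "inj_on q (fverts F)"
  proof (rule inj_onI)
    fix u v assume "u \<in> fverts F" "v \<in> fverts F" and eq: "q u = q v"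
    then obtain T T' where T: "T \<in> F" "u \<in> tverts T" "T' \<in> F" "v \<in> tverts T'"
      by (auto simp: fverts_def)
    then have "q u \<in> tverts (s T) \<inter> tverts (s T')"
      using qT[OF T(1)] qT[OF T(3)] unfolding eq by (metis IntI eq imageI)
    then have "s T = s T'" using rooted_forest_disjoint[OF F'] T sF(1) by blast
    then have "T = T'" using T sF(2) by (auto simp: inj_on_def)
    then show "u = v" using T q eq f(1)[OF T(1)] by (auto simp: bij_betw_def inj_on_def)
  qed
  then have "bij_betw q (fverts F) (fverts F')" using img by (simp add: bij_betw_def)
  moreover have "finite (fverts F)"
    using rooted_forest_forestlike[OF F] by (simp add: forestlike_def)
  ultimately obtain p where p: "bij p" "\<And>v. v \<in> fverts F \<Longrightarrow> p v = q v"
    using bij_extension by metis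
  have pv: "p ` fverts F = fverts F'" using p(2) img by simp
  have pT: "p v = f T v" if "T \<in> F" "v \<in> tverts T" for T v
  proof -
    have "v \<in> fverts F" using that by (auto simp: fverts_def)
    then show ?thesis using p(2) q[OF that] by simp
  qed
  have edges: "map_prod p p ` tedges T = tedges (s T)" if T: "T \<in> F" for T
  proof -
    have sT: "s T \<in> F'" using T sF by auto
    have E: "tedges T \<subseteq> tverts T \<times> tverts T" "tedges (s T) \<subseteq> tverts (s T) \<times> tverts (s T)"
      using rooted_forest_edges(2)[OF F T] rooted_forest_edges(2)[OF F' sT] .
    show ?thesis
    proof (intro equalityI subsetI)
      fix e assume "e \<in> map_prod p p ` tedges T"
      then obtain u v where uv: "(u, v) \<in> tedges T" "e = (p u, p v)" by auto
      moreover have "u \<in> tverts T" "v \<in> tverts T" using uv E by auto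
      ultimately show "e \<in> tedges (s T)" using f(2)[OF T] pT[OF T] by auto
    next
      fix e assume e: "e \<in> tedges (s T)"
      then have "e \<in> f T ` tverts T \<times> f T ` tverts T"
        using E(2) bij_betw_imp_surj_on[OF f(1)[OF T]] by blast
      then obtain u v where uv: "u \<in> tverts T" "v \<in> tverts T" "e = (f T u, f T v)" by blast
      then have "(u, v) \<in> tedges T" using e f(2)[OF T] by blast
      moreover have "e = map_prod p p (u, v)" using uv pT[OF T] by simp
      ultimately show "e \<in> map_prod p p ` tedges T" by blast
    qed
  qed
  have "map_prod p p ` fedges F = (\<Union>T\<in>F. tedges (s T))"
    using edges by (simp add: fedges_def image_UN)
  also have "\<dots> = fedges F'" using sF(1) by (auto simp: fedges_def)
  finally show ?thesis using that[of p] p(1) pv by simp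
qed

text \<open>In this form, symmetry and transitivity of \<open>forest_iso\<close> come from inverting
  and composing permutations.\<close>

lemma forest_iso_iff:
  assumes F: "rooted_forest F" and F': "rooted_forest F'"
  shows "forest_iso F F' \<longleftrightarrow>
    (\<exists>p. bij p \<and> fverts F' = p ` fverts F \<and> fedges F' = map_prod p p ` fedges F)" (is "_ = ?r")
proof
  assume "forest_iso F F'"
  then show ?r by (rule forest_iso_imp[OF F F']) blast
next
  assume ?r
  then obtain p where "bij p" "fverts F' = p ` fverts F" "fedges F' = map_prod p p ` fedges F"
    by blast
  then show "forest_iso F F'"
    using forest_iso_image[of p "fverts F" "fedges F"] forest_of_rooted_forest F F'
    by (metis bij_is_inj)
qed

section \<open>Isomorphism classes and subobjects of forests\<close>

lemma Obj_LRF [simp]: "Obj LRF = {F. rooted_forest F}"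
  and Isom_LRF [simp]: "Isom LRF = forest_iso"
  and Sub_LRF [simp]: "Sub LRF F = PiE F cuts"
  by (simp_all add: LRF_def)

lemma iso_equiv_LRF: "iso_equiv {F. rooted_forest F} LRF"
  unfolding iso_equiv_def
proof (intro conjI)
  show "Obj LRF \<subseteq> {F. rooted_forest F}" by simp
  show "reflp_on {F. rooted_forest F} (Isom LRF)"
    by (auto intro!: reflp_onI exI[of _ id] simp: forest_iso_iff prod.map_id0)
  show "symp_on {F. rooted_forest F} (Isom LRF)"
  proof (rule symp_onI)
    fix F F' assume FF: "F \<in> {F. rooted_forest F}" "F' \<in> {F. rooted_forest F}" "Isom LRF F F'"
    then obtain p where p: "bij p" "fverts F' = p ` fverts F" "fedges F' = map_prod p p ` fedges F"
      by (auto simp: forest_iso_iff)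
    then have "inv p \<circ> p = id" "bij (inv p)" by (auto simp: bij_imp_bij_inv bij_is_inj)
    then have "fverts F = inv p ` fverts F'" "fedges F = map_prod (inv p) (inv p) ` fedges F'"
      using p by (simp_all add: image_comp prod.map_comp prod.map_id0)
    then show "Isom LRF F' F" using FF \<open>bij (inv p)\<close> by (auto simp: forest_iso_iff)
  qed
  show "transp_on {F. rooted_forest F} (Isom LRF)"
  proof (rule transp_onI)
    fix F G H assume rf: "F \<in> {F. rooted_forest F}" "G \<in> {F. rooted_forest F}" "H \<in> {F. rooted_forest F}"
      and "Isom LRF F G" "Isom LRF G H"
    then obtain p q where
      "bij p" "fverts G = p ` fverts F" "fedges G = map_prod p p ` fedges F"
      "bij q" "fverts H = q ` fverts G" "fedges H = map_prod q q ` fedges G"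
      by (auto simp: forest_iso_iff)
    then have "bij (q \<circ> p)" "fverts H = (q \<circ> p) ` fverts F"
      "fedges H = map_prod (q \<circ> p) (q \<circ> p) ` fedges F"
      by (simp_all add: bij_comp image_comp prod.map_comp)
    then show "Isom LRF F H" using rf by (auto simp: forest_iso_iff)
  qed
qed

lemma finite_Sub_LRF:
  assumes "rooted_forest F"
  shows "finite (Sub LRF F)"
proof -
  have "down_sets (fverts F) (fedges F) \<subseteq> Pow (fverts F)" by (auto simp: down_sets_def)
  then have "finite (down_sets (fverts F) (fedges F))"
    using rooted_forest_forestlike[OF assms] by (auto simp: forestlike_def intro: finite_subset)
  then show ?thesis using bij_betw_finite[OF bij_betw_forest_cut[OF assms]] by simp
qed

lemma Sub_LRF_cases:
  assumes F: "rooted_forest F" and c: "c \<in> Sub LRF F"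
  obtains D where "D \<in> down_sets (fverts F) (fedges F)" "c = forest_cut F D"
    "subob LRF F c = forest_of D (fedges F \<inter> D \<times> D)"
    "quot LRF F c = forest_of (fverts F - D) (fedges F \<inter> (fverts F - D) \<times> (fverts F - D))"
    "forestlike D (fedges F \<inter> D \<times> D)"
    "forestlike (fverts F - D) (fedges F \<inter> (fverts F - D) \<times> (fverts F - D))"
proof -
  obtain D where D: "D \<in> down_sets (fverts F) (fedges F)" "c = forest_cut F D"
    using c bij_betw_forest_cut[OF F] by (force simp: bij_betw_def)
  moreover have "D \<subseteq> fverts F" using D by (auto simp: down_sets_def)
  ultimately show ?thesis
    using that subob_quot_forest_cut[OF F D(1)] rooted_forest_forestlike[OF F]
    by (metis Diff_subset forestlike_restrict)
qed

lemma forest_cut_Sub_LRF: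
  "rooted_forest F \<Longrightarrow> D \<in> down_sets (fverts F) (fedges F) \<Longrightarrow> forest_cut F D \<in> Sub LRF F"
  by (simp only: Sub_LRF) (rule bij_betwE[OF bij_betw_forest_cut, rule_format])

lemma down_sets_image:
  assumes "inj p"
  shows "down_sets (p ` V) (map_prod p p ` E) = (`) p ` down_sets V E"
proof (intro equalityI subsetI)
  fix D' assume D': "D' \<in> down_sets (p ` V) (map_prod p p ` E)"
  then obtain D where D: "D \<subseteq> V" "D' = p ` D" by (auto simp: down_sets_def subset_image_iff)
  have "v \<in> D" if "u \<in> D" "(u, v) \<in> E" for u v
  proof -
    have "p u \<in> D'" using that(1) D(2) by blast
    moreover have "(p u, p v) \<in> map_prod p p ` E" using that(2) by force
    ultimately have "p v \<in> D'" by (rule down_setsD[OF D'])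
    then show ?thesis by (simp add: D inj_image_mem_iff[OF assms])
  qed
  then show "D' \<in> (`) p ` down_sets V E" using D by (auto simp: down_sets_def)
next
  fix D' assume "D' \<in> (`) p ` down_sets V E"
  then obtain D where D: "D \<subseteq> V" "E `` D \<subseteq> D" "D' = p ` D" by (auto simp: down_sets_def)
  have "(map_prod p p ` E) `` (p ` D) = p ` (E `` D)" using assms by (force simp: inj_eq)
  then show "D' \<in> down_sets (p ` V) (map_prod p p ` E)"
    using D by (simp add: down_sets_def image_mono)
qed

lemma down_sets_down_set:
  "D \<in> down_sets V E \<Longrightarrow> D' \<in> down_sets D (E \<inter> D \<times> D) \<Longrightarrow> D' \<in> down_sets V E"
  unfolding down_sets_def by blast

lemma below_closed_LRF:
  assumes "M \<in> Iso LRF" "B \<in> below LRF M" "N \<in> Sub LRF (rep B)"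
  shows "cls LRF (subob LRF (rep B) N) \<in> below LRF M"
proof (rule below_closed[OF iso_equiv_LRF _ _ _ assms])
  fix F c assume "F \<in> Obj LRF" "c \<in> Sub LRF F"
  then show "subob LRF F c \<in> Obj LRF"
    by (metis Obj_LRF Sub_LRF_cases mem_Collect_eq rooted_forest_forest_of(1))
next
  fix F F' c assume "F \<in> Obj LRF" "F' \<in> Obj LRF" and iso: "Isom LRF F F'" and c: "c \<in> Sub LRF F"
  then have F: "rooted_forest F" and F': "rooted_forest F'" by auto
  obtain D where D: "D \<in> down_sets (fverts F) (fedges F)"
    "subob LRF F c = forest_of D (fedges F \<inter> D \<times> D)"
    using Sub_LRF_cases[OF F c] by metis
  obtain p where p: "bij p" "fverts F' = p ` fverts F" "fedges F' = map_prod p p ` fedges F"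
    by (rule forest_iso_imp[OF F F' iso[unfolded Isom_LRF]])
  have inj: "inj p" using p(1) by (rule bij_is_inj)
  have D': "p ` D \<in> down_sets (fverts F') (fedges F')"
    using D(1) by (simp add: p down_sets_image[OF inj])
  have "subob LRF F' (forest_cut F' (p ` D)) = forest_of (p ` D) (map_prod p p ` (fedges F \<inter> D \<times> D))"
    unfolding subob_quot_forest_cut(1)[OF F' D'] by (simp add: p map_prod_image_Int[OF inj inj])
  then have "Isom LRF (subob LRF F c) (subob LRF F' (forest_cut F' (p ` D)))"
    using forest_iso_image[OF inj] D(2) by simp
  then show "\<exists>c'\<in>Sub LRF F'. Isom LRF (subob LRF F c) (subob LRF F' c')"
    using forest_cut_Sub_LRF[OF F' D'] by blast
next
  fix F c c' assume "F \<in> Obj LRF" and c: "c \<in> Sub LRF F" and c': "c' \<in> Sub LRF (subob LRF F c)"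
  then have F: "rooted_forest F" by simp
  obtain D where D: "D \<in> down_sets (fverts F) (fedges F)"
    "subob LRF F c = forest_of D (fedges F \<inter> D \<times> D)" "forestlike D (fedges F \<inter> D \<times> D)"
    using Sub_LRF_cases[OF F c] by metis
  note sub = rooted_forest_forest_of[OF D(3), folded D(2)]
  obtain D' where D': "D' \<in> down_sets D (fedges F \<inter> D \<times> D)"
    "subob LRF (subob LRF F c) c' = forest_of D' (fedges F \<inter> D \<times> D \<inter> D' \<times> D')"
    using Sub_LRF_cases[OF sub(1) c'] unfolding sub by metis
  have "D' \<in> down_sets (fverts F) (fedges F)" using D(1) D'(1) by (rule down_sets_down_set)
  moreover have "fedges F \<inter> D \<times> D \<inter> D' \<times> D' = fedges F \<inter> D' \<times> D'"
    using D'(1) by (auto simp: down_sets_def)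
  ultimately show "\<exists>c''\<in>Sub LRF F. subob LRF (subob LRF F c) c' = subob LRF F c''"
    using D'(2) subob_quot_forest_cut(1)[OF F] forest_cut_Sub_LRF[OF F] by metis
qed

section \<open>The Hall product of forests in terms of vertex sets\<close>

lemma forestlike_image:
  assumes p: "inj p" and fl: "forestlike V E"
  shows "forestlike (p ` V) (map_prod p p ` E)"
proof -
  have "map_prod p p ` E \<subseteq> inv_image E (inv p)" using p by (auto simp: in_inv_image)
  then have "wf (map_prod p p ` E)"
    using forestlike_wf[OF fl] by (blast intro: wf_subset wf_inv_image)
  then have "acyclic (map_prod p p ` E)" by (rule wf_acyclic)
  then show ?thesis using fl p by (auto simp: forestlike_def single_valued_def inj_eq)
qed

text \<open>With one ambient digraph \<open>E\<close> kept fixed, all forests in an iterated product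
  are indexed by their vertex sets alone.\<close>

definition sub_cls :: "('s::infinite \<times> 's) set \<Rightarrow> 's set \<Rightarrow> 's rtree set set"
  where "sub_cls E A = cls LRF (forest_of A (E \<inter> A \<times> A))"

lemma sub_cls_in_Iso: "forestlike V E \<Longrightarrow> A \<subseteq> V \<Longrightarrow> sub_cls E A \<in> Iso LRF"
  unfolding sub_cls_def
  by (intro cls_in_Iso) (simp add: forestlike_restrict rooted_forest_forest_of(1))

lemma sub_cls_image:
  assumes fl: "forestlike V E" and p: "bij p" and A: "A \<subseteq> V"
  shows "sub_cls (map_prod p p ` E) (p ` A) = sub_cls E A"
proof -
  have inj: "inj p" using p by (rule bij_is_inj)
  have rA: "rooted_forest (forest_of A (E \<inter> A \<times> A))"
    using fl A by (intro rooted_forest_forest_of forestlike_restrict)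
  have "forestlike (p ` A) (map_prod p p ` (E \<inter> A \<times> A))"
    by (intro forestlike_image[OF inj] forestlike_restrict[OF fl A])
  then have "rooted_forest (forest_of (p ` A) (map_prod p p ` (E \<inter> A \<times> A)))"
    by (rule rooted_forest_forest_of)
  then show ?thesis
    unfolding sub_cls_def map_prod_image_Int[OF inj inj]
    using rA forest_iso_image[OF inj]
    by (intro cls_eqI[OF iso_equiv_LRF, symmetric]) simp_all
qed

lemma Iso_LRF_cases:
  assumes "M \<in> Iso LRF"
  obtains V E where "forestlike V E" "M = sub_cls E V"
proof -
  have r: "rooted_forest (rep M)" using rep_in_Obj[OF iso_equiv_LRF assms] by simp
  have fl: "forestlike (fverts (rep M)) (fedges (rep M))" by (rule rooted_forest_forestlike[OF r])
  then have "fedges (rep M) \<inter> fverts (rep M) \<times> fverts (rep M) = fedges (rep M)"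
    by (auto simp: forestlike_def)
  then have "M = sub_cls (fedges (rep M)) (fverts (rep M))"
    using cls_rep[OF iso_equiv_LRF assms] forest_of_rooted_forest[OF r] by (simp add: sub_cls_def)
  with fl show ?thesis using that by blast
qed

text \<open>Frees the product from the representative chosen by \<open>rep\<close>: a permutation
  \<open>p\<close> carries \<open>V\<close> and \<open>E\<close> to it, and taking images under
  \<open>p\<close> matches the closed vertex sets and preserves the classes
  \<open>sub_cls\<close>.\<close>

lemma hall_mult_LRF:
  assumes fl: "forestlike V E"
  shows "hall_mult LRF f g (sub_cls E V) =
    (\<Sum>D\<in>down_sets V E. f (sub_cls E D) * g (sub_cls E (V - D)))"
proof -
  have EV: "E \<inter> V \<times> V = E" using fl by (auto simp: forestlike_def)
  have M: "sub_cls E V \<in> Iso LRF" by (rule sub_cls_in_Iso[OF fl order_refl])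
  let ?F = "rep (sub_cls E V)"
  have F: "rooted_forest ?F" using rep_in_Obj[OF iso_equiv_LRF M] by simp
  have "Isom LRF (forest_of V E) ?F"
    using Isom_rep_cls[OF iso_equiv_LRF, of "forest_of V E"] M by (simp add: sub_cls_def EV)
  then obtain p where p: "bij p" "fverts ?F = p ` V" "fedges ?F = map_prod p p ` E"
    using forest_iso_imp[OF rooted_forest_forest_of(1)[OF fl] F]
    unfolding rooted_forest_forest_of(2,3)[OF fl] by auto
  have inj: "inj p" using p(1) by (rule bij_is_inj)
  let ?fe = "fedges ?F" and ?fv = "fverts ?F"
  have "hall_mult LRF f g (sub_cls E V) = (\<Sum>c\<in>PiE ?F cuts.
      f (cls LRF (subob LRF ?F c)) * g (cls LRF (quot LRF ?F c)))"
    using M by (simp add: hall_mult_def)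
  also have "\<dots> = (\<Sum>D\<in>down_sets ?fv ?fe. f (cls LRF (subob LRF ?F (forest_cut ?F D))) *
      g (cls LRF (quot LRF ?F (forest_cut ?F D))))"
    by (rule sum.reindex_bij_betw[OF bij_betw_forest_cut[OF F], symmetric])
  also have "\<dots> = (\<Sum>D\<in>down_sets ?fv ?fe. f (sub_cls ?fe D) * g (sub_cls ?fe (?fv - D)))"
    by (intro sum.cong refl) (simp only: subob_quot_forest_cut[OF F] sub_cls_def[symmetric])
  also have "\<dots> = (\<Sum>D\<in>(`) p ` down_sets V E. f (sub_cls ?fe D) * g (sub_cls ?fe (?fv - D)))"
    by (simp only: p down_sets_image[OF inj])
  also have "\<dots> = (\<Sum>D\<in>down_sets V E. f (sub_cls ?fe (p ` D)) * g (sub_cls ?fe (?fv - p ` D)))"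
    using inj by (intro sum.reindex_cong[of "(`) p"] inj_onI) (simp_all add: inj_image_eq_iff)
  also have "\<dots> = (\<Sum>D\<in>down_sets V E. f (sub_cls E D) * g (sub_cls E (V - D)))"
  proof (intro sum.cong refl)
    fix D assume "D \<in> down_sets V E"
    then have D: "D \<subseteq> V" by (simp add: down_sets_def)
    have "?fv - p ` D = p ` (V - D)" unfolding p using inj by (simp add: image_set_diff)
    then show "f (sub_cls ?fe (p ` D)) * g (sub_cls ?fe (?fv - p ` D)) =
        f (sub_cls E D) * g (sub_cls E (V - D))"
      using sub_cls_image[OF fl p(1)] D by (simp add: p)
  qed
  finally show ?thesis .
qed

lemma hall_mult_sub_cls:
  assumes fl: "forestlike V E" and A: "A \<subseteq> V"
  shows "hall_mult LRF f g (sub_cls E A) =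
    (\<Sum>D\<in>down_sets A (E \<inter> A \<times> A). f (sub_cls E D) * g (sub_cls E (A - D)))"
proof -
  have r: "sub_cls (E \<inter> A \<times> A) B = sub_cls E B" if "B \<subseteq> A" for B
  proof -
    have "E \<inter> A \<times> A \<inter> B \<times> B = E \<inter> B \<times> B" using that by blast
    then show ?thesis by (simp add: sub_cls_def)
  qed
  have "hall_mult LRF f g (sub_cls E A) = (\<Sum>D\<in>down_sets A (E \<inter> A \<times> A).
      f (sub_cls (E \<inter> A \<times> A) D) * g (sub_cls (E \<inter> A \<times> A) (A - D)))"
    using hall_mult_LRF[OF forestlike_restrict[OF fl A]] r by simp
  also have "\<dots> = (\<Sum>D\<in>down_sets A (E \<inter> A \<times> A). f (sub_cls E D) * g (sub_cls E (A - D)))"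
    by (intro sum.cong refl) (simp add: r down_sets_def)
  finally show ?thesis .
qed

lemma finite_down_sets: "finite V \<Longrightarrow> finite (down_sets V E)"
  by (rule finite_subset[of _ "Pow V"]) (auto simp: down_sets_def)

text \<open>Both iterated products count the chains \<open>D' \<subseteq> D \<subseteq> V\<close> of closed vertex sets.\<close>

lemma hall_assoc_LRF:
  assumes M: "M \<in> Iso LRF"
  shows "hall_assoc_at LRF M"
  unfolding hall_assoc_at_def
proof (intro ballI)
  fix f g h :: "'a rtree set set \<Rightarrow> rat"
  obtain V E where fl: "forestlike V E" and MV: "M = sub_cls E V"
    using Iso_LRF_cases[OF M] by metis
  have V: "finite V" "E \<subseteq> V \<times> V" using fl by (auto simp: forestlike_def)
  have fin: "finite A" if "A \<subseteq> V" for A using that V(1) finite_subset by blast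
  let ?S = "SIGMA D:down_sets V E. down_sets D (E \<inter> D \<times> D)"
  let ?T = "SIGMA D':down_sets V E. down_sets (V - D') (E \<inter> (V - D') \<times> (V - D'))"
  have "hall_mult LRF (hall_mult LRF f g) h M =
    (\<Sum>D\<in>down_sets V E. hall_mult LRF f g (sub_cls E D) * h (sub_cls E (V - D)))"
    unfolding MV by (rule hall_mult_LRF[OF fl])
  also have "\<dots> = (\<Sum>D\<in>down_sets V E. \<Sum>D'\<in>down_sets D (E \<inter> D \<times> D).
      f (sub_cls E D') * g (sub_cls E (D - D')) * h (sub_cls E (V - D)))"
    by (intro sum.cong refl) (simp add: down_sets_def hall_mult_sub_cls[OF fl] sum_distrib_right)
  also have "\<dots> = (\<Sum>(D, D')\<in>?S. f (sub_cls E D') * g (sub_cls E (D - D')) * h (sub_cls E (V - D)))"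
    using V fin by (intro sum.Sigma) (auto simp: down_sets_def intro: finite_down_sets[unfolded down_sets_def])
  also have "\<dots> = (\<Sum>(D', L)\<in>?T. f (sub_cls E D') * g (sub_cls E L) * h (sub_cls E (V - D' - L)))"
  \<comment> \<open>This is the correspondence between subobjects containing \<open>D'\<close> and
    subobjects of the quotient by \<open>D'\<close>: \<open>D\<close> corresponds to
    \<open>L = D - D'\<close>.\<close>
  proof (rule sum.reindex_bij_witness[where i = "\<lambda>(D', L). (D' \<union> L, D')" and j = "\<lambda>(D, D'). (D', D - D')"])
    fix x assume x: "x \<in> ?S"
    obtain D D' where xD: "x = (D, D')" by (cases x)
    have D: "D \<subseteq> V" "E `` D \<subseteq> D" "D' \<subseteq> D" "(E \<inter> D \<times> D) `` D' \<subseteq> D'"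
      using x xD by (auto simp: down_sets_def)
    show "(case case x of (D, D') \<Rightarrow> (D', D - D') of (D', L) \<Rightarrow> (D' \<union> L, D')) = x"
      using D by (auto simp: xD)
    have "D' \<in> down_sets V E" using x by (auto simp: xD intro: down_sets_down_set)
    then show "(case x of (D, D') \<Rightarrow> (D', D - D')) \<in> ?T"
      using D by (auto simp: xD down_sets_def)
    have "V - D' - (D - D') = V - D" using D by auto
    then show "(case case x of (D, D') \<Rightarrow> (D', D - D') of (D', L) \<Rightarrow>
        f (sub_cls E D') * g (sub_cls E L) * h (sub_cls E (V - D' - L))) =
      (case x of (D, D') \<Rightarrow> f (sub_cls E D') * g (sub_cls E (D - D')) * h (sub_cls E (V - D)))"
      by (simp add: xD)
  next
    fix x assume x: "x \<in> ?T"
    obtain D' L where xD: "x = (D', L)" by (cases x)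
    have D: "D' \<subseteq> V" "E `` D' \<subseteq> D'" "L \<subseteq> V - D'" "(E \<inter> (V - D') \<times> (V - D')) `` L \<subseteq> L"
      using x xD by (auto simp: down_sets_def)
    show "(case case x of (D', L) \<Rightarrow> (D' \<union> L, D') of (D, D') \<Rightarrow> (D', D - D')) = x"
      using D by (auto simp: xD)
    \<comment> \<open>\<open>L\<close> is closed only inside \<open>V - D'\<close>; a child that
      leaves \<open>V - D'\<close> falls into \<open>D'\<close>.\<close>
    have "E `` (D' \<union> L) \<subseteq> D' \<union> L" using D V(2) by blast
    then show "(case x of (D', L) \<Rightarrow> (D' \<union> L, D')) \<in> ?S"
      using D by (auto simp: xD down_sets_def)
  qed
  also have "\<dots> = (\<Sum>D'\<in>down_sets V E. \<Sum>L\<in>down_sets (V - D') (E \<inter> (V - D') \<times> (V - D')).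
      f (sub_cls E D') * g (sub_cls E L) * h (sub_cls E (V - D' - L)))"
    using V by (intro sum.Sigma[symmetric]) (auto intro: finite_down_sets)
  also have "\<dots> = (\<Sum>D'\<in>down_sets V E. f (sub_cls E D') * hall_mult LRF g h (sub_cls E (V - D')))"
    by (intro sum.cong refl) (simp add: hall_mult_sub_cls[OF fl] sum_distrib_left mult.assoc)
  also have "\<dots> = hall_mult LRF f (hall_mult LRF g h) M"
    unfolding MV by (rule hall_mult_LRF[OF fl, symmetric])
  finally show "hall_mult LRF (hall_mult LRF f g) h M = hall_mult LRF f (hall_mult LRF g h) M" .
qed

lemma hall_mult_in_Hall_LRF:
  fixes f g :: "'s::infinite rtree set set \<Rightarrow> rat"
  assumes "f \<in> Hall LRF" "g \<in> Hall LRF"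
  shows "hall_mult LRF f g \<in> Hall LRF"
proof (rule hall_mult_in_Hall[OF iso_equiv_LRF, where size = "\<lambda>F. card (fverts F)"])
  fix F :: "'s rtree set" and c assume "F \<in> Obj LRF" and c: "c \<in> Sub LRF F"
  then have F: "rooted_forest F" by simp
  obtain D where "subob LRF F c = forest_of D (fedges F \<inter> D \<times> D)"
    "quot LRF F c = forest_of (fverts F - D) (fedges F \<inter> (fverts F - D) \<times> (fverts F - D))"
    "forestlike D (fedges F \<inter> D \<times> D)"
    "forestlike (fverts F - D) (fedges F \<inter> (fverts F - D) \<times> (fverts F - D))"
    "D \<in> down_sets (fverts F) (fedges F)"
    by (rule Sub_LRF_cases[OF F c])
  moreover have "finite (fverts F)" using rooted_forest_forestlike[OF F] by (simp add: forestlike_def)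
  ultimately show "subob LRF F c \<in> {F. rooted_forest F} \<and> quot LRF F c \<in> {F. rooted_forest F}"
    and "card (fverts F) \<le> card (fverts (subob LRF F c)) + card (fverts (quot LRF F c))"
    by (auto simp: rooted_forest_forest_of down_sets_def card_Diff_subset finite_subset card_mono)
next
  fix F F' :: "'s rtree set"
  assume "F \<in> {F. rooted_forest F}" "F' \<in> {F. rooted_forest F}" "Isom LRF F F'"
  then obtain p where "bij p" "fverts F' = p ` fverts F" by (auto simp: forest_iso_iff)
  then show "card (fverts F) = card (fverts F')"
    by (metis bij_is_inj card_image inj_on_subset subset_UNIV)
next
  fix n
  obtain W :: "'s set" where W: "finite W" "card W = n"
    using infinite_arbitrarily_large[OF infinite_UNIV] by blast
  \<comment> \<open>Every forest with at most \<open>n\<close> vertices has a copy with labels in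
    \<open>W\<close>. The finitely many digraphs on \<open>W\<close> include some that are not
    forests, which is harmless for an upper bound.\<close>
  let ?c = "\<lambda>(V, E). cls LRF (forest_of V E)"
  have "cls LRF ` {F \<in> Obj LRF. card (fverts F :: 's set) \<le> n} \<subseteq> ?c ` (Pow W \<times> Pow (W \<times> W))"
  proof
    fix M assume "M \<in> cls LRF ` {F \<in> Obj LRF. card (fverts F :: 's set) \<le> n}"
    then obtain F where F: "rooted_forest F" "card (fverts F) \<le> n" "M = cls LRF F" by auto
    have fl: "forestlike (fverts F) (fedges F)" by (rule rooted_forest_forestlike[OF F(1)])
    then have "finite (fverts F)" by (simp add: forestlike_def)
    then obtain p where p: "bij p" "p ` fverts F \<subseteq> W" using bij_into[OF _ W(1), of "fverts F"] W(2) F(2) by auto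
    have inj: "inj p" using p(1) by (rule bij_is_inj)
    have fl': "forestlike (p ` fverts F) (map_prod p p ` fedges F)"
      by (rule forestlike_image[OF inj fl])
    have "forest_iso F (forest_of (p ` fverts F) (map_prod p p ` fedges F))"
      using forest_iso_image[OF inj] forest_of_rooted_forest[OF F(1)] by metis
    then have "M = ?c (p ` fverts F, map_prod p p ` fedges F)"
      using F rooted_forest_forest_of(1)[OF fl']
      by (simp add: cls_eqI[OF iso_equiv_LRF, of F "forest_of (p ` fverts F) (map_prod p p ` fedges F)"])
    moreover have "map_prod p p ` fedges F \<subseteq> W \<times> W"
      using fl' p(2) unfolding forestlike_def by blast
    ultimately show "M \<in> ?c ` (Pow W \<times> Pow (W \<times> W))" using p(2) by blast
  qed
  then show "finite (cls LRF ` {F \<in> Obj LRF. card (fverts F :: 's set) \<le> n})"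
    by (rule finite_subset) (use W(1) in simp)
qed (use assms in auto)

lemma LRF_module:
  assumes M: "M \<in> Iso LRF"
  shows "finite_dim (H_below LRF M)"
    "lie_module (hall_prim LRF) (hall_bracket LRF) (H_below LRF M) (left_top_elim LRF)"
proof -
  have fin: "finite (Sub LRF (rep B))" if "B \<in> Iso LRF" for B :: "'a rtree set set"
    using rep_in_Obj[OF iso_equiv_LRF that] finite_Sub_LRF by auto
  then show "finite_dim (H_below LRF M)" using M by (intro finite_dim_H_below)
  show "lie_module (hall_prim LRF) (hall_bracket LRF) (H_below LRF M) (left_top_elim LRF)"
    by (intro lie_module_H_below fin below_closed_LRF[OF M] hall_mult_in_Hall_LRF hall_assoc_LRF)
      (auto simp: below_def)
qed

section \<open>Images of Feynman graphs\<close>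

definition image_graph :: "('v \<Rightarrow> 'v) \<Rightarrow> ('h \<Rightarrow> 'h) \<Rightarrow> ('v, 'h) hgraph \<Rightarrow> ('v, 'h) hgraph"
  where "image_graph p q G = \<lparr>verts = p ` verts G, halfs = q ` halfs G,
    att = map_prod q p ` att G, adj = map_prod q q ` adj G\<rparr>"

lemma image_graph_sel [simp]:
  "verts (image_graph p q G) = p ` verts G" "halfs (image_graph p q G) = q ` halfs G"
  "att (image_graph p q G) = map_prod q p ` att G" "adj (image_graph p q G) = map_prod q q ` adj G"
  by (simp_all add: image_graph_def)

text \<open>Distinct components keep distinct images, so the number of components that enters
  \<open>loop_number\<close> is preserved.\<close>

lemma inj_image_graph:
  assumes "inj p" "inj q"
  shows "inj (image_graph p q)"
proof (rule injI)
  fix G G' assume eq: "image_graph p q G = image_graph p q G'"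
  have "inj (map_prod q p)" "inj (map_prod q q)" using assms by (simp_all add: prod.inj_map)
  with assms eq show "G = G'"
    by (cases G; cases G') (auto simp: image_graph_def inj_image_eq_iff)
qed

context
  fixes p :: "'v \<Rightarrow> 'v" and q :: "'h \<Rightarrow> 'h"
  assumes p: "inj p" and q: "inj q"
begin

lemma half_edge_graph_image:
  assumes G: "half_edge_graph G"
  shows "half_edge_graph (image_graph p q G)"
proof -
  have "\<exists>!v. (q h, v) \<in> map_prod q p ` att G" if "h \<in> halfs G" for h
  proof -
    have "\<exists>!v. (h, v) \<in> att G" using G that by (simp add: half_edge_graph_def)
    then obtain v where v: "(h, v) \<in> att G" "\<And>w. (h, w) \<in> att G \<Longrightarrow> w = v" by blast
    show ?thesis
    proof (rule ex1I)
      show "(q h, p v) \<in> map_prod q p ` att G" using v(1) by force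
      fix w assume "(q h, w) \<in> map_prod q p ` att G"
      then show "w = p v" using v(2) q by (auto simp: inj_eq)
    qed
  qed
  moreover have "single_valued (map_prod q q ` adj G)" "sym (map_prod q q ` adj G)"
    "irrefl (map_prod q q ` adj G)"
    using G q by (auto simp: half_edge_graph_def single_valued_def sym_def irrefl_def inj_eq; blast)+
  ultimately show ?thesis using G by (auto simp: half_edge_graph_def)
qed

lemma external_image: "external (image_graph p q G) = q ` external G"
  using q by (auto simp: external_def inj_eq)

lemma internal_image: "internal (image_graph p q G) = (`) q ` internal G"
proof -
  have "internal G = (\<lambda>(h, h'). {h, h'}) ` adj G" for G :: "('v, 'h) hgraph"
    by (auto simp: internal_def)
  then show ?thesis by (auto simp: image_image case_prod_beta)
qed

lemma card_internal_image: "card (internal (image_graph p q G)) = card (internal G)"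
  unfolding internal_image using q by (intro card_image inj_onI) (simp add: inj_image_eq_iff)

lemma vlink_image: "vlink (image_graph p q G) = map_prod p p ` vlink G"
proof (intro equalityI subrelI)
  fix x y assume "(x, y) \<in> vlink (image_graph p q G)"
  then obtain h h' where h: "(h, x) \<in> map_prod q p ` att G" "(h', y) \<in> map_prod q p ` att G"
    "(h, h') \<in> map_prod q q ` adj G" unfolding vlink_def image_graph_sel mem_Collect_eq prod.case by metis
  from h(1) obtain a v where av: "h = q a" "x = p v" "(a, v) \<in> att G" by auto
  from h(2) obtain b w where bw: "h' = q b" "y = p w" "(b, w) \<in> att G" by auto
  have "(a, b) \<in> adj G" using h(3) unfolding av bw mem_map_prod_image[OF q q] .
  then have "(v, w) \<in> vlink G" using av bw by (auto simp: vlink_def)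
  moreover have "(x, y) = map_prod p p (v, w)" by (simp add: av bw)
  ultimately show "(x, y) \<in> map_prod p p ` vlink G" by blast
next
  fix x y assume "(x, y) \<in> map_prod p p ` vlink G"
  then obtain v w h h' where "x = p v" "y = p w" "(h, v) \<in> att G" "(h', w) \<in> att G" "(h, h') \<in> adj G"
    by (auto simp: vlink_def)
  then have "(q h, x) \<in> map_prod q p ` att G" "(q h', y) \<in> map_prod q p ` att G"
    "(q h, q h') \<in> map_prod q q ` adj G" by force+
  then show "(x, y) \<in> vlink (image_graph p q G)"
    unfolding vlink_def image_graph_sel mem_Collect_eq prod.case by metis
qed

lemma full_subgraph_image:
  "full_subgraph (image_graph p q G) (p ` U) = image_graph p q (full_subgraph G U)"
proof -
  have H: "{h \<in> q ` halfs G. \<exists>v\<in>p ` U. (h, v) \<in> map_prod q p ` att G} =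
      q ` {h \<in> halfs G. \<exists>v\<in>U. (h, v) \<in> att G}"
  proof (intro equalityI subsetI)
    fix h assume "h \<in> {h \<in> q ` halfs G. \<exists>v\<in>p ` U. (h, v) \<in> map_prod q p ` att G}"
    then have "h \<in> q ` halfs G" and "\<exists>v\<in>p ` U. (h, v) \<in> map_prod q p ` att G" by simp_all
    then obtain h' v where h': "h' \<in> halfs G" "h = q h'" "v \<in> U" and
      e: "(q h', p v) \<in> map_prod q p ` att G" by (elim imageE bexE) simp
    have "(h', v) \<in> att G" using e unfolding mem_map_prod_image[OF q p] .
    with h' show "h \<in> q ` {h \<in> halfs G. \<exists>v\<in>U. (h, v) \<in> att G}" by blast
  qed force
  show ?thesis
    unfolding full_subgraph_def image_graph_sel H Let_def
    by (simp add: image_graph_def map_prod_image_Int[OF q p] map_prod_image_Int[OF q q])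
qed

lemma components_image: "components (image_graph p q G) = image_graph p q ` components G"
proof -
  have "components (image_graph p q G) =
      (\<lambda>v. full_subgraph (image_graph p q G) ((vlink (image_graph p q G))\<^sup>* `` {v})) ` p ` verts G"
    unfolding components_def by auto
  also have "\<dots> = image_graph p q ` (\<lambda>v. full_subgraph G ((vlink G)\<^sup>* `` {v})) ` verts G"
    by (simp add: image_image vlink_image rtrancl_map_prod_image[OF p] full_subgraph_image)
  also have "\<dots> = image_graph p q ` components G"
    unfolding components_def by auto
  finally show ?thesis .
qed

lemma loop_number_image: "loop_number (image_graph p q G) = loop_number G"
proof -
  have "card (components (image_graph p q G)) = card (components G)"
    unfolding components_image by (meson card_image inj_image_graph inj_on_subset p q subset_UNIV)
  moreover have "card (verts (image_graph p q G)) = card (verts G)"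
    by (simp add: card_image inj_on_subset[OF p])
  ultimately show ?thesis by (simp add: loop_number_def card_internal_image)
qed

text \<open>A subgraph has to be a Feynman graph itself, so carrying subgraphs across an isomorphism
  requires invariance of all clauses: valence, external half-edges and loop number of each
  component.\<close>

lemma feynman_image:
  assumes G: "feynman G"
  shows "feynman (image_graph p q G)"
  unfolding feynman_def
proof (intro conjI ballI)
  show "half_edge_graph (image_graph p q G)"
    using G by (simp add: feynman_def half_edge_graph_image)
next
  fix w assume "w \<in> verts (image_graph p q G)"
  then obtain v where v: "w = p v" "v \<in> verts G" by auto
  have "{h. (h, w) \<in> att (image_graph p q G)} = q ` {h. (h, v) \<in> att G}"
    using p by (auto simp: v inj_eq)
  then show "card {h. (h, w) \<in> att (image_graph p q G)} = 3"
    using G v(2) by (simp add: feynman_def card_image inj_on_subset[OF q])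
next
  fix K assume "K \<in> components (image_graph p q G)"
  then obtain L where "L \<in> components G" "K = image_graph p q L" by (auto simp: components_image)
  then show "card (external K) \<in> {2, 3}" "loop_number K \<ge> 1"
    using G by (auto simp: feynman_def external_image loop_number_image card_image inj_on_subset[OF q])
qed

end

lemma graph_iso_image:
  assumes "inj p" "inj q"
  shows "graph_iso G (image_graph p q G)"
  unfolding graph_iso_def
  by (intro exI[of _ p] exI[of _ q])
    (auto simp: mem_map_prod_image assms intro!: bij_betw_imageI inj_on_subset[OF assms(1)]
      inj_on_subset[OF assms(2)])

text \<open>\<open>graph_iso\<close> compares incidences only between listed vertices and
  half-edges. In a \<open>half_edge_graph\<close> there are no others, so the isomorphism, extended
  to permutations of both label types, carries \<open>G\<close> exactly to
  \<open>G'\<close>.\<close>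

lemma graph_iso_imp_image:
  assumes G: "half_edge_graph G" and G': "half_edge_graph G'" and iso: "graph_iso G G'"
  obtains p q where "bij p" "bij q" "G' = image_graph p q G"
proof -
  obtain f k where f: "bij_betw f (verts G) (verts G')" and k: "bij_betw k (halfs G) (halfs G')"
    and att: "\<And>h v. h \<in> halfs G \<Longrightarrow> v \<in> verts G \<Longrightarrow> (h, v) \<in> att G \<longleftrightarrow> (k h, f v) \<in> att G'"
    and adj: "\<And>h h'. h \<in> halfs G \<Longrightarrow> h' \<in> halfs G \<Longrightarrow> (h, h') \<in> adj G \<longleftrightarrow> (k h, k h') \<in> adj G'"
    using iso unfolding graph_iso_def by blast
  obtain p where p: "bij p" "\<And>x. x \<in> verts G \<Longrightarrow> p x = f x"
    using bij_extension[OF _ f] G by (auto simp: half_edge_graph_def)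
  obtain q where q: "bij q" "\<And>x. x \<in> halfs G \<Longrightarrow> q x = k x"
    using bij_extension[OF _ k] G by (auto simp: half_edge_graph_def)
  have pV: "p ` verts G = verts G'" using p(2) bij_betw_imp_surj_on[OF f] by simp
  have qH: "q ` halfs G = halfs G'" using q(2) bij_betw_imp_surj_on[OF k] by simp
  have att_sub: "att G \<subseteq> halfs G \<times> verts G" "att G' \<subseteq> q ` halfs G \<times> p ` verts G"
    and adj_sub: "adj G \<subseteq> halfs G \<times> halfs G" "adj G' \<subseteq> q ` halfs G \<times> q ` halfs G"
    using G G' by (auto simp: half_edge_graph_def pV qH)
  have "att G' = map_prod q p ` att G"
  proof (intro equalityI subsetI)
    fix e assume e: "e \<in> att G'"
    then obtain h v where hv: "h \<in> halfs G" "v \<in> verts G" "e = (q h, p v)" using att_sub(2) by blast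
    then have "(h, v) \<in> att G" using e att p(2) q(2) by simp
    then show "e \<in> map_prod q p ` att G" using hv by force
  next
    fix e assume "e \<in> map_prod q p ` att G"
    then obtain h v where hv: "(h, v) \<in> att G" "e = (q h, p v)" by auto
    moreover then have "h \<in> halfs G" "v \<in> verts G" using att_sub(1) by auto
    ultimately show "e \<in> att G'" using att p(2) q(2) by simp
  qed
  moreover have "adj G' = map_prod q q ` adj G"
  proof (intro equalityI subsetI)
    fix e assume e: "e \<in> adj G'"
    then obtain h v where hv: "h \<in> halfs G" "v \<in> halfs G" "e = (q h, q v)" using adj_sub(2) by blast
    then have "(h, v) \<in> adj G" using e adj q(2) by simp
    then show "e \<in> map_prod q q ` adj G" using hv by force
  next
    fix e assume "e \<in> map_prod q q ` adj G"
    then obtain h v where hv: "(h, v) \<in> adj G" "e = (q h, q v)" by auto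
    moreover then have "h \<in> halfs G" "v \<in> halfs G" using adj_sub(1) by auto
    ultimately show "e \<in> adj G'" using adj q(2) by simp
  qed
  ultimately have "G' = image_graph p q G"
    using pV qH by (cases G') (simp add: image_graph_def)
  with p(1) q(1) show ?thesis using that by blast
qed

section \<open>The Hall product of Feynman graphs\<close>

lemma Obj_LFG [simp]: "Obj LFG = {G. feynman G}"
  and Isom_LFG [simp]: "Isom LFG = graph_iso"
  and Sub_LFG [simp]: "Sub LFG G = {g. subgraph g G}"
  and subob_LFG [simp]: "subob LFG G g = g"
  and quot_LFG [simp]: "quot LFG = quot_graph"
  by (simp_all add: LFG_def)

section \<open>Isomorphism of half-edge graphs as an equivalence relation\<close>

lemma graph_iso_refl: "graph_iso G G"
  unfolding graph_iso_def by (intro exI[of _ id]) auto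

lemma graph_iso_sym:
  assumes "graph_iso G G'"
  shows "graph_iso G' G"
proof -
  obtain f k where f: "bij_betw f (verts G) (verts G')" and k: "bij_betw k (halfs G) (halfs G')"
    and att: "\<And>h v. h \<in> halfs G \<Longrightarrow> v \<in> verts G \<Longrightarrow> (h, v) \<in> att G \<longleftrightarrow> (k h, f v) \<in> att G'"
    and adj: "\<And>h h'. h \<in> halfs G \<Longrightarrow> h' \<in> halfs G \<Longrightarrow> (h, h') \<in> adj G \<longleftrightarrow> (k h, k h') \<in> adj G'"
    using assms unfolding graph_iso_def by blast
  let ?f = "inv_into (verts G) f" and ?k = "inv_into (halfs G) k"
  have f': "?f v \<in> verts G" "f (?f v) = v" if "v \<in> verts G'" for v
    using f that by (metis bij_betw_imp_surj_on inv_into_into, metis bij_betw_imp_surj_on f_inv_into_f)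
  have k': "?k h \<in> halfs G" "k (?k h) = h" if "h \<in> halfs G'" for h
    using k that by (metis bij_betw_imp_surj_on inv_into_into, metis bij_betw_imp_surj_on f_inv_into_f)
  show ?thesis
    unfolding graph_iso_def
    by (intro exI[of _ ?f] exI[of _ ?k])
      (simp add: bij_betw_inv_into[OF f] bij_betw_inv_into[OF k] att adj f' k')
qed

lemma graph_iso_trans:
  assumes "graph_iso G G'" "graph_iso G' G''"
  shows "graph_iso G G''"
proof -
  obtain f k where f: "bij_betw f (verts G) (verts G')" and k: "bij_betw k (halfs G) (halfs G')"
    and att: "\<And>h v. h \<in> halfs G \<Longrightarrow> v \<in> verts G \<Longrightarrow> (h, v) \<in> att G \<longleftrightarrow> (k h, f v) \<in> att G'"
    and adj: "\<And>h h'. h \<in> halfs G \<Longrightarrow> h' \<in> halfs G \<Longrightarrow> (h, h') \<in> adj G \<longleftrightarrow> (k h, k h') \<in> adj G'"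
    using assms(1) unfolding graph_iso_def by blast
  obtain f' k' where f': "bij_betw f' (verts G') (verts G'')" and k': "bij_betw k' (halfs G') (halfs G'')"
    and att': "\<And>h v. h \<in> halfs G' \<Longrightarrow> v \<in> verts G' \<Longrightarrow> (h, v) \<in> att G' \<longleftrightarrow> (k' h, f' v) \<in> att G''"
    and adj': "\<And>h h'. h \<in> halfs G' \<Longrightarrow> h' \<in> halfs G' \<Longrightarrow> (h, h') \<in> adj G' \<longleftrightarrow> (k' h, k' h') \<in> adj G''"
    using assms(2) unfolding graph_iso_def by blast
  have "f v \<in> verts G'" if "v \<in> verts G" for v using f that by (rule bij_betw_apply)
  moreover have "k h \<in> halfs G'" if "h \<in> halfs G" for h using k that by (rule bij_betw_apply)
  ultimately show ?thesis
    unfolding graph_iso_def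
    by (intro exI[of _ "f' \<circ> f"] exI[of _ "k' \<circ> k"])
      (simp add: bij_betw_trans[OF f f'] bij_betw_trans[OF k k'] att att' adj adj')
qed

lemma iso_equiv_LFG: "iso_equiv UNIV LFG"
  unfolding iso_equiv_def
  by (auto intro!: reflp_onI symp_onI transp_onI graph_iso_refl
      intro: graph_iso_sym graph_iso_trans)

lemma feynman_half_edge_graph: "feynman G \<Longrightarrow> half_edge_graph G"
  by (simp add: feynman_def)

section \<open>Subgraphs: transport, transitivity, finiteness\<close>

lemma subgraph_image:
  assumes p: "inj p" and q: "inj q" and g: "subgraph g G"
  shows "subgraph (image_graph p q g) (image_graph p q G)"
proof -
  have *: "h \<in> q ` halfs g" if v: "v \<in> p ` verts g" and hv: "(h, v) \<in> map_prod q p ` att G" for h v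
  proof -
    from hv obtain h' v' where "(h', v') \<in> att G" "h = q h'" "v = p v'" by auto
    moreover then have "v' \<in> verts g" using v p by (simp add: inj_image_mem_iff)
    ultimately show ?thesis using g by (auto simp: subgraph_def)
  qed
  have "map_prod q p ` att g = map_prod q p ` att G \<inter> q ` halfs g \<times> p ` verts g"
    "map_prod q q ` adj g = map_prod q q ` adj G \<inter> q ` halfs g \<times> q ` halfs g"
    using g unfolding map_prod_image_Int[OF q p] map_prod_image_Int[OF q q]
    by (simp_all add: subgraph_def)
  moreover have "feynman g" "verts g \<subseteq> verts G" "halfs g \<subseteq> halfs G"
    using g by (simp_all add: subgraph_def)
  ultimately show ?thesis
    unfolding subgraph_def image_graph_sel
    by (intro conjI allI impI feynman_image[OF p q] image_mono) (assumption | (erule conjE, erule *, assumption))+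
qed

lemma subgraph_trans:
  assumes "subgraph k g" "subgraph g G"
  shows "subgraph k G"
proof -
  have "h \<in> halfs k" if "v \<in> verts k" "(h, v) \<in> att G" for h v
  proof -
    have "v \<in> verts g" using assms(1) that(1) by (auto simp: subgraph_def)
    moreover then have "h \<in> halfs g" using assms(2) that(2) unfolding subgraph_def by blast
    ultimately have "(h, v) \<in> att g" using assms(2) that(2) by (simp add: subgraph_def)
    then show ?thesis using assms(1) that(1) unfolding subgraph_def by blast
  qed
  moreover have "feynman k" "verts k \<subseteq> verts g" "halfs k \<subseteq> halfs g"
    "att k = att g \<inter> halfs k \<times> verts k" "adj k = adj g \<inter> halfs k \<times> halfs k"
    using assms(1) by (simp_all add: subgraph_def)
  moreover have "verts g \<subseteq> verts G" "halfs g \<subseteq> halfs G"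
    "att g = att G \<inter> halfs g \<times> verts g" "adj g = adj G \<inter> halfs g \<times> halfs g"
    using assms(2) by (simp_all add: subgraph_def)
  ultimately show ?thesis unfolding subgraph_def by (intro conjI) auto
qed

text \<open>Incidences are inherited, so a subgraph is determined by its vertices and
  half-edges.\<close>

lemma finite_Sub_LFG:
  assumes "feynman G"
  shows "finite (Sub LFG G)"
proof -
  let ?c = "\<lambda>(V, H). \<lparr>verts = V, halfs = H, att = att G \<inter> H \<times> V, adj = adj G \<inter> H \<times> H\<rparr>"
  have "finite (Pow (verts G) \<times> Pow (halfs G))"
    using assms by (simp add: feynman_def half_edge_graph_def)
  moreover have "Sub LFG G \<subseteq> ?c ` (Pow (verts G) \<times> Pow (halfs G))"
  proof
    fix g assume "g \<in> Sub LFG G"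
    then have g: "subgraph g G" by simp
    then have "g = ?c (verts g, halfs g)" by (cases g) (simp add: subgraph_def)
    moreover have "(verts g, halfs g) \<in> Pow (verts G) \<times> Pow (halfs G)"
      using g by (simp add: subgraph_def)
    ultimately show "g \<in> ?c ` (Pow (verts G) \<times> Pow (halfs G))" by blast
  qed
  ultimately show ?thesis by (meson finite_imageI finite_subset)
qed

lemma below_closed_LFG:
  assumes "M \<in> Iso LFG" "B \<in> below LFG M" "N \<in> Sub LFG (rep B)"
  shows "cls LFG (subob LFG (rep B) N) \<in> below LFG M"
proof (rule below_closed[OF iso_equiv_LFG _ _ _ assms])
  fix G g assume "G \<in> Obj LFG" "g \<in> Sub LFG G"
  then show "subob LFG G g \<in> Obj LFG" by (simp add: subgraph_def)
next
  fix G G' g assume "G \<in> Obj LFG" "G' \<in> Obj LFG" "Isom LFG G G'" and g: "g \<in> Sub LFG G"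
  then have "half_edge_graph G" "half_edge_graph G'" "graph_iso G G'"
    by (simp_all add: feynman_half_edge_graph)
  then obtain p q where "bij p" "bij q" "G' = image_graph p q G"
    by (rule graph_iso_imp_image)
  then have "inj p" "inj q" "image_graph p q g \<in> Sub LFG G'"
    using g by (auto simp: bij_is_inj subgraph_image)
  then show "\<exists>g'\<in>Sub LFG G'. Isom LFG (subob LFG G g) (subob LFG G' g')"
    using graph_iso_image by (metis Isom_LFG subob_LFG)
next
  fix G g k assume "G \<in> Obj LFG" "g \<in> Sub LFG G" "k \<in> Sub LFG (subob LFG G g)"
  then show "\<exists>k'\<in>Sub LFG G. subob LFG (subob LFG G g) k = subob LFG G k'"
    using subgraph_trans by auto
qed

section \<open>Vertices that survive in a quotient graph\<close>

lemma verts_quot_connected: "verts G - verts K \<subseteq> verts (quot_connected G K)"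
  by (auto simp: quot_connected_def Let_def)

lemma verts_foldl_quot_connected:
  "verts G - (\<Union>K\<in>set Ks. verts K) \<subseteq> verts (foldl quot_connected G Ks)"
proof (induction Ks arbitrary: G)
  case (Cons K Ks)
  have "verts G - (\<Union>L\<in>set (K # Ks). verts L)
      \<subseteq> verts (quot_connected G K) - (\<Union>L\<in>set Ks. verts L)"
    using verts_quot_connected[of G K] by auto
  also have "\<dots> \<subseteq> verts (foldl quot_connected (quot_connected G K) Ks)" by (rule Cons.IH)
  finally show ?case by simp
qed simp

lemma verts_component:
  assumes g: "half_edge_graph g" and K: "K \<in> components g"
  shows "verts K \<subseteq> verts g"
proof -
  obtain v where v: "v \<in> verts g" "verts K = (vlink g)\<^sup>* `` {v}"
    using K by (auto simp: components_def full_subgraph_def Let_def)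
  have "vlink g \<subseteq> verts g \<times> verts g" using g by (auto simp: vlink_def half_edge_graph_def)
  have "w \<in> verts g" if "(v, w) \<in> (vlink g)\<^sup>*" for w
    using that
  proof (induction rule: rtrancl_induct)
    case base
    show ?case by (rule v(1))
  qed (use \<open>vlink g \<subseteq> verts g \<times> verts g\<close> in auto)
  then show ?thesis using v by auto
qed

text \<open>The inclusion holds for every order of the components, so the arbitrary choice in
  \<open>quot_graph\<close> does not matter; finiteness of the set of components makes the choice a
  genuine enumeration. This is the lower bound on the quotient behind the size inequality.\<close>

lemma verts_quot_graph:
  assumes g: "half_edge_graph g"
  shows "verts G - verts g \<subseteq> verts (quot_graph G g)"
proof -
  have "components g = (\<lambda>v. full_subgraph g ((vlink g)\<^sup>* `` {v})) ` verts g"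
    unfolding components_def by auto
  then have "finite (components g)" using g by (simp add: half_edge_graph_def)
  then have "\<exists>Ks. distinct Ks \<and> set Ks = components g" using finite_distinct_list by blast
  then have "set (SOME Ks. distinct Ks \<and> set Ks = components g) = components g"
    by (rule someI2_ex) simp
  then show ?thesis
    using verts_foldl_quot_connected[of G "SOME Ks. distinct Ks \<and> set Ks = components g"]
      verts_component[OF g] unfolding quot_graph_def by auto
qed

text \<open>Every half-edge sits at a vertex, and each vertex has three. Hence the number of
  vertices alone can serve as the size of a Feynman graph.\<close>

lemma card_halfs_feynman:
  assumes "feynman G"
  shows "card (halfs G) \<le> 3 * card (verts G)"
proof -
  have G: "half_edge_graph G" and fin: "finite (verts G)"
    using assms by (auto simp: feynman_def half_edge_graph_def)
  have "\<exists>v\<in>verts G. (h, v) \<in> att G" if "h \<in> halfs G" for h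
    using G that unfolding half_edge_graph_def by blast
  then have "halfs G = (\<Union>v\<in>verts G. {h. (h, v) \<in> att G})"
    using G unfolding half_edge_graph_def by blast
  then have "card (halfs G) \<le> (\<Sum>v\<in>verts G. card {h. (h, v) \<in> att G})"
    using card_UN_le[OF fin] by metis
  also have "\<dots> = (\<Sum>v\<in>verts G. 3)" using assms by (intro sum.cong) (auto simp: feynman_def)
  finally show ?thesis by simp
qed

lemma graph_iso_verts:
  assumes "graph_iso G G'"
  shows "card (verts G) = card (verts G')" "finite (verts G) \<longleftrightarrow> finite (verts G')"
  using assms unfolding graph_iso_def by (auto dest: bij_betw_same_card bij_betw_finite)

lemma hall_mult_in_Hall_LFG:
  fixes f g :: "('v::infinite, 'h::infinite) hgraph set \<Rightarrow> rat"
  assumes "f \<in> Hall LFG" "g \<in> Hall LFG"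
  shows "hall_mult LFG f g \<in> Hall LFG"
proof (rule hall_mult_in_Hall[OF iso_equiv_LFG, where size = "\<lambda>G. card (verts G)"])
  fix G :: "('v, 'h) hgraph" and g
  assume "G \<in> Obj LFG" "g \<in> Sub LFG G" and q: "cls LFG (quot LFG G g) \<in> Iso LFG"
  then have G: "feynman G" and g: "subgraph g G" by auto
  have sub: "verts G - verts g \<subseteq> verts (quot_graph G g)"
    using g by (intro verts_quot_graph) (simp add: subgraph_def feynman_def)
  \<comment> \<open>Comparing cardinalities requires a finite quotient. Its finiteness is read off
    from the Feynman representative of its class.\<close>
  have "feynman (rep (cls LFG (quot_graph G g)))" using rep_in_Obj[OF iso_equiv_LFG q] by simp
  then have "finite (verts (quot_graph G g))"
    using Isom_rep_cls[OF iso_equiv_LFG q] graph_iso_verts(2)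
    by (auto simp: feynman_def half_edge_graph_def)
  then have "card (verts G - verts g) \<le> card (verts (quot_graph G g))" using sub by (rule card_mono)
  then show "card (verts G) \<le> card (verts (subob LFG G g)) + card (verts (quot LFG G g))"
    using diff_card_le_card_Diff[of "verts g" "verts G"] G g
    by (auto simp: subgraph_def feynman_def half_edge_graph_def)
next
  fix G G' :: "('v, 'h) hgraph" assume "Isom LFG G G'"
  then show "card (verts G) = card (verts G')" by (simp add: graph_iso_verts)
next
  fix n
  obtain W :: "'v set" where W: "finite W" "card W = n"
    using infinite_arbitrarily_large[OF infinite_UNIV] by blast
  \<comment> \<open>At most \<open>n\<close> trivalent vertices carry at most \<open>3 * n\<close>
    half-edges, so \<open>X\<close> has room for all of them.\<close>
  obtain X :: "'h set" where X: "finite X" "card X = 3 * n"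
    using infinite_arbitrarily_large[OF infinite_UNIV] by blast
  let ?c = "\<lambda>(V, H, A, J). cls LFG \<lparr>verts = V, halfs = H, att = A, adj = J\<rparr>"
  let ?P = "Pow W \<times> Pow X \<times> Pow (X \<times> W) \<times> Pow (X \<times> X)"
  have "cls LFG ` {G \<in> Obj LFG. card (verts (G :: ('v, 'h) hgraph)) \<le> n} \<subseteq> ?c ` ?P"
  proof
    fix M assume "M \<in> cls LFG ` {G \<in> Obj LFG. card (verts (G :: ('v, 'h) hgraph)) \<le> n}"
    then obtain G :: "('v, 'h) hgraph" where
      G: "feynman G" "card (verts G) \<le> n" "M = cls LFG G" by auto
    have h: "half_edge_graph G" using G(1) by (rule feynman_half_edge_graph)
    obtain p where p: "bij p" "p ` verts G \<subseteq> W"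
      using bij_into[OF _ W(1), of "verts G"] W(2) G(2) h by (auto simp: half_edge_graph_def)
    have "card (halfs G) \<le> card X" using card_halfs_feynman[OF G(1)] G(2) X(2) by simp
    then obtain q where q: "bij q" "q ` halfs G \<subseteq> X"
      using bij_into[OF _ X(1), of "halfs G"] h by (auto simp: half_edge_graph_def)
    let ?G = "image_graph p q G"
    have "graph_iso G ?G" using p(1) q(1) by (intro graph_iso_image bij_is_inj)
    then have "M = cls LFG ?G"
      unfolding G(3) by (intro cls_eqI[OF iso_equiv_LFG]) auto
    also have "\<dots> = ?c (verts ?G, halfs ?G, att ?G, adj ?G)" by (simp add: image_graph_def)
    finally have "M = ?c (verts ?G, halfs ?G, att ?G, adj ?G)" .
    moreover have "half_edge_graph ?G"
      using p(1) q(1) h by (intro half_edge_graph_image bij_is_inj)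
    then have "att ?G \<subseteq> halfs ?G \<times> verts ?G" "adj ?G \<subseteq> halfs ?G \<times> halfs ?G"
      unfolding half_edge_graph_def by auto
    moreover have "verts ?G \<subseteq> W" "halfs ?G \<subseteq> X" using p(2) q(2) by auto
    ultimately have "M = ?c (verts ?G, halfs ?G, att ?G, adj ?G)"
      "(verts ?G, halfs ?G, att ?G, adj ?G) \<in> ?P" by blast+
    then show "M \<in> ?c ` ?P" by (rule image_eqI)
  qed
  moreover have "finite (?c ` ?P)" using W(1) X(1) by simp
  ultimately show "finite (cls LFG ` {G \<in> Obj LFG. card (verts (G :: ('v, 'h) hgraph)) \<le> n})"
    by (rule finite_subset)
qed (use assms in auto)

text \<open>Stability rests on subgraphs of subgraphs being subgraphs. The bracket relation draws in
  addition on associativity at the classes below \<open>M\<close>, which is a premise here, whereas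
  \<open>hall_assoc_LRF\<close> proves it for forests.\<close>

lemma LFG_module:
  assumes M: "M \<in> Iso LFG"
  shows "finite_dim (H_below LFG M)"
    "stable_action (hall_prim LFG) (H_below LFG M) (left_top_elim LFG)"
    "\<forall>E \<in> below LFG M. hall_assoc_at LFG E \<Longrightarrow>
      lie_module (hall_prim LFG) (hall_bracket LFG) (H_below LFG M) (left_top_elim LFG)"
proof -
  have fin: "finite (Sub LFG (rep B))" if "B \<in> Iso LFG" for B :: "('a, 'b) hgraph set"
    using rep_in_Obj[OF iso_equiv_LFG that] by (intro finite_Sub_LFG) simp
  then show "finite_dim (H_below LFG M)" using M by (intro finite_dim_H_below)
  show "stable_action (hall_prim LFG) (H_below LFG M) (left_top_elim LFG)"
    by (intro stable_action_H_below fin below_closed_LFG[OF M])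
  show "lie_module (hall_prim LFG) (hall_bracket LFG) (H_below LFG M) (left_top_elim LFG)"
    if "\<forall>E \<in> below LFG M. hall_assoc_at LFG E"
    using that by (intro lie_module_H_below fin below_closed_LFG[OF M] hall_mult_in_Hall_LFG) auto
qed

theorem theorem4:
  shows "(\<forall>M \<in> Iso (LRF :: ('s::infinite rtree set, 's rtree \<Rightarrow> 's cut) hall_cat).
            H_below LRF M \<subseteq> Hall_dual LRF \<and>
            finite_dim (H_below LRF M) \<and>
            lie_module (hall_prim LRF) (hall_bracket LRF) (H_below LRF M) (left_top_elim LRF))
       \<and> (\<forall>M \<in> Iso (LFG :: (('v::infinite, 'h::infinite) hgraph, ('v, 'h) hgraph) hall_cat).
            H_below LFG M \<subseteq> Hall_dual LFG \<and>
            finite_dim (H_below LFG M) \<and>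
            stable_action (hall_prim LFG) (H_below LFG M) (left_top_elim LFG) \<and>
            ((\<forall>E \<in> below LFG M. hall_assoc_at LFG E) \<longrightarrow>
              lie_module (hall_prim LFG) (hall_bracket LFG) (H_below LFG M) (left_top_elim LFG)))"
proof (intro conjI ballI impI)
  show "H_below LRF M \<subseteq> Hall_dual LRF" for M :: "'s rtree set set"
    by (rule H_below_subset_Hall_dual)
  show "H_below LFG M \<subseteq> Hall_dual LFG" for M :: "('v, 'h) hgraph set"
    by (rule H_below_subset_Hall_dual)
qed (simp_all add: LRF_module LFG_module)

end
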